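(* Consider a 2-cell downlink network with BSs 1, 2, each with $N_t\ge2$ antennas, and one single-antenna user per cell. Channels $\mathbf{h}_{i,j}\in\mathbb{C}^{N_t}$ ($i,j\in\{1,2\}$) are mutually independent with i.i.d. $\mathcal{CN}(0,1)$ entries, and perfect channel knowledge is available at the BSs. Each BS $j$ selects $s_j\in\{BF,IC\}$ with precoder $\mathbf{f}_{j,s_j}$ as in the context. Given fixed (deterministic) received powers $P^r_{1,1},P^r_{1,2}>0$, define $$\mathrm{SINR}_1(s_1,s_2)=\frac{P^r_{1,1}|\mathbf{h}_{1,1}^*\mathbf{f}_{1,s_1}|^2}{1+P^r_{1,2}|\mathbf{h}_{1,2}^*\mathbf{f}_{2,s_2}|^2},\qquad R_1(s_1,s_2)=\mathbb{E}[\log_2(1+\mathrm{SINR}_1(s_1,s_2))].$$ Then $R_1(BF,BF)=R_I^{(2)}(P^r_{1,1},P^r_{1,2},N_t)$, $R_1(BF,IC)=R_{BF}(P^r_{1,1},N_t)$, $R_1(IC,IC)=R_{BF}(P^r_{1,1},N_t-1)$, and $R_1(IC,BF)=R_I^{(2)}(P^r_{1,1},P^r_{1,2},N_t-1)$.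
   Context: Precoders: $\mathbf{f}_{j,BF}=\mathbf{h}_{j,j}/\|\mathbf{h}_{j,j}\|$; for $IC$, BS $j$ cancels interference to the user of the other cell $k\neq j$: $\mathbf{f}_{j,IC}=\mathbf{w}/\|\mathbf{w}\|$ with $\mathbf{w}=\big(\mathbf{I}-\mathbf{h}_{k,j}\mathbf{h}_{k,j}^*/\|\mathbf{h}_{k,j}\|^2\big)\mathbf{h}_{j,j}$. Functions: for $\gamma>0$ and integer $M\ge1$, $R_{BF}(\gamma,M)=\log_2(e)\,e^{1/\gamma}\sum_{k=0}^{M-1}\frac{\Gamma(-k,1/\gamma)}{\gamma^k}$, where $\Gamma(s,x)=\int_x^\infty t^{s-1}e^{-t}dt$ is the upper incomplete gamma function; $R_I^{(2)}(\gamma_1,\gamma_2,M)=\log_2(e)\sum_{i=0}^{M-1}\sum_{l=0}^{i}\frac{\gamma_1^{\,l+1-i}}{\gamma_2(i-l)!}I_1\!\left(\frac1{\gamma_1},\frac{\gamma_1}{\gamma_2},i,l+1\right)$, with $I_1(a,b,m,n)=\int_0^\infty\frac{x^me^{-ax}}{(x+b)^n(x+1)}dx$. *)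

theory Defs
  imports "HOL-Probability.Probability"
begin

definition upper_inc_gamma :: "real \<Rightarrow> real \<Rightarrow> real" where
  "upper_inc_gamma s x = (\<integral>t\<in>{x<..}. t powr (s - 1) * exp (- t) \<partial>lborel)"

definition R_BF :: "real \<Rightarrow> nat \<Rightarrow> real" where
  "R_BF \<gamma> M = log 2 (exp 1) * exp (1 / \<gamma>) *
     (\<Sum>k<M. upper_inc_gamma (- real k) (1 / \<gamma>) / \<gamma> ^ k)"

definition I1 :: "real \<Rightarrow> real \<Rightarrow> nat \<Rightarrow> nat \<Rightarrow> real" where
  "I1 a b m n = (\<integral>x\<in>{0<..}. x ^ m * exp (- a * x) / ((x + b) ^ n * (x + 1)) \<partial>lborel)"

definition R_I2 :: "real \<Rightarrow> real \<Rightarrow> nat \<Rightarrow> real" where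
  "R_I2 \<gamma>1 \<gamma>2 M = log 2 (exp 1) *
     (\<Sum>i<M. \<Sum>l\<le>i. \<gamma>1 powi (int l + 1 - int i) / (\<gamma>2 * fact (i - l))
                      * I1 (1 / \<gamma>1) (\<gamma>1 / \<gamma>2) i (l + 1))"

(* ---------- vectors in C^Nt, represented as nat => complex on indices {..<Nt} ---------- *)

definition cinner :: "nat \<Rightarrow> (nat \<Rightarrow> complex) \<Rightarrow> (nat \<Rightarrow> complex) \<Rightarrow> complex" where
  "cinner Nt x y = (\<Sum>k<Nt. cnj (x k) * y k)"

definition vnorm :: "nat \<Rightarrow> (nat \<Rightarrow> complex) \<Rightarrow> real" where
  "vnorm Nt x = sqrt (\<Sum>k<Nt. (cmod (x k))\<^sup>2)"

definition bf_prec :: "nat \<Rightarrow> (nat \<Rightarrow> complex) \<Rightarrow> (nat \<Rightarrow> complex)" where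
  "bf_prec Nt h = (\<lambda>k. h k / complex_of_real (vnorm Nt h))"

text \<open>f_IC = w / ||w||, w = (I - g g^* / ||g||^2) h, where h = own direct channel,
  g = channel from this BS to the other cell's user.\<close>
definition ic_prec :: "nat \<Rightarrow> (nat \<Rightarrow> complex) \<Rightarrow> (nat \<Rightarrow> complex) \<Rightarrow> (nat \<Rightarrow> complex)" where
  "ic_prec Nt g h =
     (let w = (\<lambda>k. h k - g k * cinner Nt g h / complex_of_real ((vnorm Nt g)\<^sup>2))
      in (\<lambda>k. w k / complex_of_real (vnorm Nt w)))"

datatype strategy = BF | IC

definition prec :: "nat \<Rightarrow> strategy \<Rightarrow> (nat \<Rightarrow> complex) \<Rightarrow> (nat \<Rightarrow> complex) \<Rightarrow> (nat \<Rightarrow> complex)" where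
  "prec Nt s g h = (case s of BF \<Rightarrow> bf_prec Nt h | IC \<Rightarrow> ic_prec Nt g h)"

definition CN_std :: "complex measure" where
  "CN_std = density lborel (\<lambda>z. ennreal (exp (- (cmod z)\<^sup>2) / pi))"

text \<open>Outcome omega: (i,j,k) maps to the k-th entry of h_{i,j} (channel from BS j to user i),
  for i,j in {1,2}, k < Nt; all entries i.i.d. CN(0,1).\<close>
definition chan_space :: "nat \<Rightarrow> (nat \<times> nat \<times> nat \<Rightarrow> complex) measure" where
  "chan_space Nt = PiM ({1,2} \<times> {1,2} \<times> {..<Nt}) (\<lambda>_. CN_std)"

definition chan :: "(nat \<times> nat \<times> nat \<Rightarrow> complex) \<Rightarrow> nat \<Rightarrow> nat \<Rightarrow> (nat \<Rightarrow> complex)" where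
  "chan \<omega> i j = (\<lambda>k. \<omega> (i, j, k))"

text \<open>f_{1,s}: BS 1 (direct channel h_{1,1}, cancels towards user 2 via h_{2,1});
      f_{2,s}: BS 2 (direct channel h_{2,2}, cancels towards user 1 via h_{1,2}).\<close>
definition SINR1 :: "nat \<Rightarrow> real \<Rightarrow> real \<Rightarrow> strategy \<Rightarrow> strategy \<Rightarrow> (nat \<times> nat \<times> nat \<Rightarrow> complex) \<Rightarrow> real" where
  "SINR1 Nt P11 P12 s1 s2 \<omega> =
     (let f1 = prec Nt s1 (chan \<omega> 2 1) (chan \<omega> 1 1);
          f2 = prec Nt s2 (chan \<omega> 1 2) (chan \<omega> 2 2)
      in P11 * (cmod (cinner Nt (chan \<omega> 1 1) f1))\<^sup>2
         / (1 + P12 * (cmod (cinner Nt (chan \<omega> 1 2) f2))\<^sup>2))"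

definition rate1 :: "nat \<Rightarrow> real \<Rightarrow> real \<Rightarrow> strategy \<Rightarrow> strategy \<Rightarrow> real" where
  "rate1 Nt P11 P12 s1 s2 = (\<integral>\<omega>. log 2 (1 + SINR1 Nt P11 P12 s1 s2 \<omega>) \<partial>chan_space Nt)"

end

theory Submission
  imports Defs
begin

text \<open>
  Zero forcing removes the interference exactly, so only two laws are needed: projecting a standard
  complex Gaussian vector on an independent nonzero direction gives an exponential power, and the
  remaining power is an independent sum of one exponential fewer. Both follow by induction on
  the dimension from the invariance of a pair of standard complex Gaussians under unitary
  rotations, and these rotations are products of three shears, which preserve Lebesgue measure by
  translation invariance. The rates are then obtained from
  \<open>E ln (1 + S) = \<integral> P (S > t) / (1 + t) dt\<close>, where the Erlang tail is a finite sum. The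
  incomplete gamma function enters through \<open>1 / (1 + t) = \<integral> exp (- r (1 + t)) dr\<close>.
\<close>

subsection \<open>The standard complex Gaussian\<close>

text \<open>The signal gain of user 1 involves only the channels \<open>h_{1,1}\<close> and
  \<open>h_{2,1}\<close>, the interference gain only \<open>h_{1,2}\<close> and
  \<open>h_{2,2}\<close>, so the two are independent. IC leaves the squared norm of a Gaussian
  vector with one dimension removed, which is the origin of \<open>Nt - 1\<close>; an interfering
  beam is seen along a single dimension, so its power is exponential whatever \<open>Nt\<close> is.
  Zero directions, where division by zero yields 0 and the projection law breaks down, form a null
  set. Nearly all integrals are nonnegative extended ones, for which Fubini asks only for
  measurability. Real integrals appear only where \<open>I1\<close>, \<open>upper_inc_gamma\<close>
  and \<open>rate1\<close> are defined by them; finiteness is checked for the first two, and the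
  rates inherit it from their closed forms.\<close>

lemma nn_integral_shear_fst:
  fixes f :: "complex \<Rightarrow> complex \<Rightarrow> ennreal"
  assumes [measurable]: "case_prod f \<in> borel_measurable (borel \<Otimes>\<^sub>M borel)"
  shows "(\<integral>\<^sup>+z. \<integral>\<^sup>+w. f (z + p * w) w \<partial>lborel \<partial>lborel) = (\<integral>\<^sup>+z. \<integral>\<^sup>+w. f z w \<partial>lborel \<partial>lborel)"
proof -
  have shift: "(\<integral>\<^sup>+z. f (z + p * w) w \<partial>lborel) = (\<integral>\<^sup>+z. f z w \<partial>lborel)" for w
  proof -
    have "(\<integral>\<^sup>+z. f z w \<partial>lborel) = (\<integral>\<^sup>+z. f z w \<partial>distr lborel borel ((+) (p * w)))"
      by (simp add: lborel_distr_plus)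
    also have "\<dots> = (\<integral>\<^sup>+z. f (z + p * w) w \<partial>lborel)"
      by (subst nn_integral_distr) (auto simp: add.commute)
    finally show ?thesis by simp
  qed
  have "(\<integral>\<^sup>+z. \<integral>\<^sup>+w. f (z + p * w) w \<partial>lborel \<partial>lborel)
      = (\<integral>\<^sup>+w. \<integral>\<^sup>+z. f (z + p * w) w \<partial>lborel \<partial>lborel)"
    by (rule lborel_pair.Fubini'[symmetric]) measurable
  also have "\<dots> = (\<integral>\<^sup>+w. \<integral>\<^sup>+z. f z w \<partial>lborel \<partial>lborel)"
    by (simp only: shift)
  also have "\<dots> = (\<integral>\<^sup>+z. \<integral>\<^sup>+w. f z w \<partial>lborel \<partial>lborel)"
    by (rule lborel_pair.Fubini') measurable
  finally show ?thesis .
qed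

lemma nn_integral_shear_snd:
  fixes f :: "complex \<Rightarrow> complex \<Rightarrow> ennreal"
  assumes [measurable]: "case_prod f \<in> borel_measurable (borel \<Otimes>\<^sub>M borel)"
  shows "(\<integral>\<^sup>+z. \<integral>\<^sup>+w. f z (w + q * z) \<partial>lborel \<partial>lborel) = (\<integral>\<^sup>+z. \<integral>\<^sup>+w. f z w \<partial>lborel \<partial>lborel)"
proof -
  have "(\<integral>\<^sup>+z. \<integral>\<^sup>+w. f z (w + q * z) \<partial>lborel \<partial>lborel)
      = (\<integral>\<^sup>+w. \<integral>\<^sup>+z. f z (w + q * z) \<partial>lborel \<partial>lborel)"
    by (rule lborel_pair.Fubini'[symmetric]) measurable
  also have "\<dots> = (\<integral>\<^sup>+w. \<integral>\<^sup>+z. f z w \<partial>lborel \<partial>lborel)"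
    by (rule nn_integral_shear_fst[where f="\<lambda>w z. f z w"]) measurable
  also have "\<dots> = (\<integral>\<^sup>+z. \<integral>\<^sup>+w. f z w \<partial>lborel \<partial>lborel)"
    by (rule lborel_pair.Fubini') measurable
  finally show ?thesis .
qed

text \<open>The matrix with rows \<open>(s, cnj c)\<close> and \<open>(- c, s)\<close> has
  determinant 1 and factors into shears upper, lower, upper. The factorisation divides by
  \<open>c\<close>; for \<open>c = 0\<close> the condition \<open>s \<ge> 0\<close> forces
  \<open>s = 1\<close>, so the map is the identity.\<close>

lemma nn_integral_lborel_unitary:
  fixes f :: "complex \<Rightarrow> complex \<Rightarrow> ennreal" and s :: real and c :: complex
  assumes f[measurable]: "case_prod f \<in> borel_measurable (borel \<Otimes>\<^sub>M borel)"
    and s: "s \<ge> 0" and sc: "s\<^sup>2 + (cmod c)\<^sup>2 = 1"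
  shows "(\<integral>\<^sup>+z. \<integral>\<^sup>+w. f (of_real s * z + cnj c * w) (of_real s * w - c * z) \<partial>lborel \<partial>lborel)
       = (\<integral>\<^sup>+z. \<integral>\<^sup>+w. f z w \<partial>lborel \<partial>lborel)"
proof (cases "c = 0")
  case True
  with s sc have "s = 1"
    by (simp add: power2_eq_1_iff)
  with True show ?thesis by simp
next
  case False
  \<comment> \<open>These values are forced: the product of the three shears has diagonal entries
    \<open>1 + p * q\<close>, lower left entry \<open>q\<close> and upper right entry
    \<open>p * (1 + p * q) + p\<close>. The first two fix \<open>p\<close> and \<open>q\<close>; the
    third is then \<open>(1 - s\<^sup>2) / c = cnj c\<close>.\<close>
  define p where "p = (1 - of_real s) / c"
  define q where "q = - c"
  have ss: "complex_of_real s * of_real s = 1 - c * cnj c"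
    using sc by (simp add: complex_norm_square[symmetric] power2_eq_square flip: of_real_mult of_real_diff)
       (metis add_diff_cancel_right' of_real_1 of_real_diff of_real_mult)
  have pq: "1 + p * q = of_real s"
    using False by (simp add: p_def q_def)
  have psp: "p * of_real s + p = cnj c"
  proof -
    have "(1 - of_real s) * of_real s + (1 - of_real s) = c * cnj c"
      using ss by (simp add: algebra_simps)
    then show ?thesis
      using False unfolding p_def by (simp add: field_simps)
  qed
  have a: "z + p * w + p * (w + q * (z + p * w)) = of_real s * z + cnj c * w" for z w
  proof -
    have "z + p * w + p * (w + q * (z + p * w)) = (1 + p * q) * z + (p * (1 + p * q) + p) * w"
      by (simp add: algebra_simps)
    then show ?thesis by (simp add: pq psp)
  qed
  have b: "w + q * (z + p * w) = of_real s * w - c * z" for z w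
  proof -
    have "w + q * (z + p * w) = (1 + p * q) * w + q * z"
      by (simp add: algebra_simps)
    then show ?thesis by (simp add: pq) (simp add: q_def)
  qed
  have "(\<integral>\<^sup>+z. \<integral>\<^sup>+w. f z w \<partial>lborel \<partial>lborel) = (\<integral>\<^sup>+z. \<integral>\<^sup>+w. f (z + p * w) w \<partial>lborel \<partial>lborel)"
    by (rule nn_integral_shear_fst[symmetric]) measurable
  also have "\<dots> = (\<integral>\<^sup>+z. \<integral>\<^sup>+w. f (z + p * (w + q * z)) (w + q * z) \<partial>lborel \<partial>lborel)"
    by (rule nn_integral_shear_snd[symmetric, where f="\<lambda>z w. f (z + p * w) w"]) measurable
  also have "\<dots> = (\<integral>\<^sup>+z. \<integral>\<^sup>+w. f (z + p * w + p * (w + q * (z + p * w))) (w + q * (z + p * w)) \<partial>lborel \<partial>lborel)"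
    by (rule nn_integral_shear_fst[symmetric, where f="\<lambda>z w. f (z + p * (w + q * z)) (w + q * z)"]) measurable
  finally show ?thesis
    unfolding a unfolding b ..
qed

lemma sets_CN_std[measurable_cong, simp]: "sets CN_std = sets borel"
  by (simp add: CN_std_def)

lemma space_CN_std[simp]: "space CN_std = UNIV"
  by (simp add: CN_std_def)

lemma nn_integral_CN_std:
  "f \<in> borel_measurable borel \<Longrightarrow>
    (\<integral>\<^sup>+z. f z \<partial>CN_std) = (\<integral>\<^sup>+z. ennreal (exp (- (cmod z)\<^sup>2) / pi) * f z \<partial>lborel)"
  unfolding CN_std_def by (rule nn_integral_density) measurable

lemma norm_unitary2:
  assumes "s\<^sup>2 + (cmod c)\<^sup>2 = 1"
  shows "(cmod (of_real s * z + cnj c * w))\<^sup>2 + (cmod (of_real s * w - c * z))\<^sup>2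
       = (cmod z)\<^sup>2 + (cmod w)\<^sup>2"
proof -
  have "(cmod (of_real s * z + cnj c * w))\<^sup>2 + (cmod (of_real s * w - c * z))\<^sup>2
     = (s\<^sup>2 + (cmod c)\<^sup>2) * ((cmod z)\<^sup>2 + (cmod w)\<^sup>2)"
    by (simp only: cmod_power2 complex_eq_iff Re_complex_of_real) (simp add: power2_eq_square algebra_simps)
  then show ?thesis using assms by simp
qed

text \<open>The joint density of two independent standard complex Gaussians depends only on the sum
  of the squared moduli, which the rotation preserves, as it does Lebesgue measure.\<close>

lemma nn_integral_CN_std_unitary:
  fixes f :: "complex \<Rightarrow> complex \<Rightarrow> ennreal" and s :: real and c :: complex
  assumes f[measurable]: "case_prod f \<in> borel_measurable (borel \<Otimes>\<^sub>M borel)"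
    and s: "s \<ge> 0" and sc: "s\<^sup>2 + (cmod c)\<^sup>2 = 1"
  shows "(\<integral>\<^sup>+z. \<integral>\<^sup>+w. f (of_real s * z + cnj c * w) (of_real s * w - c * z) \<partial>CN_std \<partial>CN_std)
       = (\<integral>\<^sup>+z. \<integral>\<^sup>+w. f z w \<partial>CN_std \<partial>CN_std)"
proof -
  define d where "d = (\<lambda>z w. ennreal (exp (- ((cmod z)\<^sup>2 + (cmod w)\<^sup>2)) / (pi * pi)))"
  have [measurable]: "case_prod d \<in> borel_measurable (borel \<Otimes>\<^sub>M borel)"
    unfolding d_def by measurable
  have expand: "(\<integral>\<^sup>+z. \<integral>\<^sup>+w. g z w \<partial>CN_std \<partial>CN_std) = (\<integral>\<^sup>+z. \<integral>\<^sup>+w. d z w * g z w \<partial>lborel \<partial>lborel)"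
    if [measurable]: "case_prod g \<in> borel_measurable (borel \<Otimes>\<^sub>M borel)"
    for g :: "complex \<Rightarrow> complex \<Rightarrow> ennreal"
  proof -
    have d: "d z w * g z w
      = ennreal (exp (- (cmod z)\<^sup>2) / pi) * (ennreal (exp (- (cmod w)\<^sup>2) / pi) * g z w)" for z w
      unfolding d_def
      by (simp add: mult.assoc[symmetric] ennreal_mult[symmetric] exp_add[symmetric])
    have inner: "(\<integral>\<^sup>+w. g z w \<partial>CN_std) = (\<integral>\<^sup>+w. ennreal (exp (- (cmod w)\<^sup>2) / pi) * g z w \<partial>lborel)" for z
      by (rule nn_integral_CN_std) measurable
    have "(\<integral>\<^sup>+z. \<integral>\<^sup>+w. g z w \<partial>CN_std \<partial>CN_std) = (\<integral>\<^sup>+z. ennreal (exp (- (cmod z)\<^sup>2) / pi) *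
        (\<integral>\<^sup>+w. ennreal (exp (- (cmod w)\<^sup>2) / pi) * g z w \<partial>lborel) \<partial>lborel)"
      unfolding inner by (rule nn_integral_CN_std) measurable
    also have "\<dots> = (\<integral>\<^sup>+z. \<integral>\<^sup>+w. d z w * g z w \<partial>lborel \<partial>lborel)"
      unfolding d by (intro nn_integral_cong nn_integral_cmult[symmetric]) measurable
    finally show ?thesis .
  qed
  have inv: "d (of_real s * z + cnj c * w) (of_real s * w - c * z) = d z w" for z w
    unfolding d_def by (simp only: norm_unitary2[OF sc])
  have "(\<integral>\<^sup>+z. \<integral>\<^sup>+w. f z w \<partial>CN_std \<partial>CN_std) = (\<integral>\<^sup>+z. \<integral>\<^sup>+w. d z w * f z w \<partial>lborel \<partial>lborel)"
    by (rule expand) measurable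
  also have "\<dots> = (\<integral>\<^sup>+z. \<integral>\<^sup>+w. d (of_real s * z + cnj c * w) (of_real s * w - c * z)
       * f (of_real s * z + cnj c * w) (of_real s * w - c * z) \<partial>lborel \<partial>lborel)"
    by (rule nn_integral_lborel_unitary[OF _ s sc, symmetric, where f="\<lambda>z w. d z w * f z w"]) measurable
  also have "\<dots> = (\<integral>\<^sup>+z. \<integral>\<^sup>+w. f (of_real s * z + cnj c * w) (of_real s * w - c * z) \<partial>CN_std \<partial>CN_std)"
    unfolding inv by (rule expand[symmetric]) measurable
  finally show ?thesis by simp
qed

text \<open>The disc of radius \<open>sqrt a\<close> has area \<open>pi * a\<close>, linear in
  \<open>a\<close>. Agreement on the half-lines, an intersection-stable generator, then settles all
  Borel sets; this stands in for polar coordinates.\<close>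

lemma distr_lborel_norm_square:
  "distr lborel borel (\<lambda>z::complex. (cmod z)\<^sup>2)
     = density lborel (\<lambda>t. ennreal (pi * indicator {0..} t))" (is "?M = ?N")
proof (rule measure_eqI_generator_eq[where E="range (\<lambda>a::real. {..a})" and A="\<lambda>i. {..real i}" and \<Omega>=UNIV])
  show "Int_stable (range (\<lambda>a::real. {..a}))"
    by (auto simp: Int_stable_def)
  show "sets ?M = sigma_sets UNIV (range atMost)" "sets ?N = sigma_sets UNIV (range atMost)"
    by (simp_all add: borel_eq_atMost)
  have M: "emeasure ?M {..a} = ennreal (pi * max 0 a)" for a
  proof -
    have "(\<lambda>z::complex. (cmod z)\<^sup>2) -` {..a} = (if a < 0 then {} else cball 0 (sqrt a))"
      by (auto simp: real_le_rsqrt dest: order_trans[OF zero_le_power2])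
         (metis norm_ge_zero not_less power2_le_imp_le power_mono real_sqrt_ge_0_iff real_sqrt_pow2)
    then show ?thesis
      by (auto simp: emeasure_distr emeasure_cball unit_ball_vol_2 max_def)
  qed
  have N: "emeasure ?N {..a} = ennreal (pi * max 0 a)" for a
  proof -
    have "emeasure ?N {..a} = (\<integral>\<^sup>+t. ennreal pi * indicator {0..a} t \<partial>lborel)"
      by (auto simp: emeasure_density intro!: nn_integral_cong split: split_indicator)
    also have "\<dots> = ennreal (pi * max 0 a)"
      by (auto simp: nn_integral_cmult ennreal_mult max_def)
    finally show ?thesis .
  qed
  show "emeasure ?M X = emeasure ?N X" if "X \<in> range atMost" for X
    using that M N by auto
  show "range (\<lambda>i. {..real i}) \<subseteq> range atMost" by auto
  show "(\<Union>i. {..real i}) = UNIV"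
    by (auto simp: real_arch_simple)
  show "emeasure ?M {..real i} \<noteq> \<infinity>" for i
    by (simp add: M)
qed auto

lemma distr_CN_std_norm_square:
  "distr CN_std borel (\<lambda>z. (cmod z)\<^sup>2) = density lborel (exponential_density 1)"
proof (rule measure_eqI)
  fix A assume "A \<in> sets (distr CN_std borel (\<lambda>z. (cmod z)\<^sup>2))"
  then have [measurable]: "A \<in> sets borel" by simp
  have "emeasure (distr CN_std borel (\<lambda>z. (cmod z)\<^sup>2)) A = (\<integral>\<^sup>+z. indicator A ((cmod z)\<^sup>2) \<partial>CN_std)"
    by (subst nn_integral_indicator[symmetric], simp, subst nn_integral_distr) auto
  also have "\<dots> = (\<integral>\<^sup>+z. ennreal (exp (- (cmod z)\<^sup>2) / pi) * indicator A ((cmod z)\<^sup>2) \<partial>lborel)"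
    by (rule nn_integral_CN_std) measurable
  also have "\<dots> = (\<integral>\<^sup>+t. ennreal (exp (- t) / pi) * indicator A t \<partial>distr lborel borel (\<lambda>z::complex. (cmod z)\<^sup>2))"
    by (subst nn_integral_distr) auto
  also have "\<dots> = (\<integral>\<^sup>+t. ennreal (pi * indicator {0..} t) * (ennreal (exp (- t) / pi) * indicator A t) \<partial>lborel)"
    unfolding distr_lborel_norm_square by (subst nn_integral_density) auto
  also have "\<dots> = (\<integral>\<^sup>+t. ennreal (exponential_density 1 t) * indicator A t \<partial>lborel)"
    by (rule nn_integral_cong)
       (auto simp: exponential_density_def ennreal_mult[symmetric] split: split_indicator)
  also have "\<dots> = emeasure (density lborel (exponential_density 1)) A"
    by (rule emeasure_density[symmetric]) auto
  finally show "emeasure (distr CN_std borel (\<lambda>z. (cmod z)\<^sup>2)) A = emeasure (density lborel (exponential_density 1)) A" .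
qed simp

text \<open>An image measure keeps the total mass, so the Gaussian is normalised because its squared
  modulus has an exponential law.\<close>

lemma prob_space_CN_std: "prob_space CN_std"
proof -
  have "prob_space (distr CN_std borel (\<lambda>z. (cmod z)\<^sup>2))"
    unfolding distr_CN_std_norm_square by (rule prob_space_exponential_density) simp
  then have "emeasure CN_std (space CN_std) = 1"
    by (drule_tac prob_space.emeasure_space_1) (simp add: emeasure_distr)
  then show ?thesis by (rule prob_spaceI)
qed

subsection \<open>Projections of Gaussian vectors\<close>

abbreviation CN_vec :: "nat \<Rightarrow> (nat \<Rightarrow> complex) measure" where
  "CN_vec n \<equiv> PiM {..<n} (\<lambda>_. CN_std)"

lemma product_prob_space_CN_std: "product_prob_space (\<lambda>_. CN_std)"
  using prob_space_CN_std prob_space_imp_sigma_finite[OF prob_space_CN_std]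
  by (simp add: product_prob_space_def product_prob_space_axioms_def product_sigma_finite_def)

lemma prob_space_CN_vec: "prob_space (CN_vec n)"
  by (rule prob_space_PiM) (rule prob_space_CN_std)

lemma measurable_cinner[measurable]: "cinner n u \<in> borel_measurable (CN_vec n)"
  unfolding cinner_def[abs_def] by measurable

lemma cinner_Suc_upd:
  "cinner (Suc n) u (x(n := y)) = cinner n u x + cnj (u n) * y"
  unfolding cinner_def by simp

lemma nn_integral_CN_vec_Suc:
  assumes "f \<in> borel_measurable (CN_vec (Suc n))"
  shows "(\<integral>\<^sup>+h. f h \<partial>CN_vec (Suc n)) = (\<integral>\<^sup>+h. \<integral>\<^sup>+y. f (h(n := y)) \<partial>CN_std \<partial>CN_vec n)"
proof -
  interpret product_prob_space "\<lambda>_::nat. CN_std"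
    by (rule product_prob_space_CN_std)
  show ?thesis
    using assms unfolding lessThan_Suc by (intro product_nn_integral_insert) auto
qed

text \<open>The component of a Gaussian vector along a unit vector \<open>u\<close> and the squared
  length of the rest are jointly distributed like one Gaussian coordinate and the squared norm of
  \<open>n\<close> further independent ones. Both must be tracked jointly, because adding a
  coordinate mixes the old component with the new entry. The sign condition on \<open>u 0\<close>
  makes the one-dimensional case trivial, since there it forces \<open>u 0 = 1\<close>, and it
  survives the passage to a shorter vector.\<close>

lemma nn_integral_CN_vec_projection:
  fixes F :: "complex \<Rightarrow> real \<Rightarrow> ennreal"
  assumes F: "case_prod F \<in> borel_measurable (borel \<Otimes>\<^sub>M borel)"
    and u0: "Im (u 0) = 0" "Re (u 0) \<ge> 0" and u: "(\<Sum>k<Suc n. (cmod (u k))\<^sup>2) = 1"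
  shows "(\<integral>\<^sup>+h. F (cinner (Suc n) u h)
            ((\<Sum>k<Suc n. (cmod (h k))\<^sup>2) - (cmod (cinner (Suc n) u h))\<^sup>2) \<partial>CN_vec (Suc n))
       = (\<integral>\<^sup>+a. \<integral>\<^sup>+h. F a (\<Sum>k<n. (cmod (h k))\<^sup>2) \<partial>CN_vec n \<partial>CN_std)"
  using assms
proof (induction n arbitrary: u F)
  case 0
  note [measurable] = 0(1)
  have "(Re (u 0))\<^sup>2 = 1"
    using 0 by (simp add: cmod_power2)
  with 0 have "u 0 = 1"
    by (simp add: complex_eq_iff power2_eq_1_iff)
  then show ?case
    by (subst nn_integral_CN_vec_Suc) (simp_all add: cinner_def PiM_empty nn_integral_count_space_finite)
next
  case (Suc n)
  note [measurable] = Suc.prems(1)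
  interpret CN: prob_space CN_std by (rule prob_space_CN_std)
  interpret V: prob_space "CN_vec n" by (rule prob_space_CN_vec)
  interpret P: pair_sigma_finite CN_std "CN_vec n" ..
  define s where "s = sqrt (\<Sum>k<Suc n. (cmod (u k))\<^sup>2)"
  define c where "c = u (Suc n)"
  \<comment> \<open>The direction is split as \<open>u = (s v, c)\<close> with \<open>v\<close>
    again a unit vector. If \<open>s = 0\<close>, any admissible unit vector serves, since
    \<open>v\<close> is only used multiplied by \<open>s\<close>.\<close>
  define v :: "nat \<Rightarrow> complex"
    where "v = (if s = 0 then (\<lambda>k. if k = 0 then 1 else 0) else (\<lambda>k. u k / of_real s))"
  have s0: "s \<ge> 0"
    unfolding s_def by (intro real_sqrt_ge_zero sum_nonneg) auto
  have s2: "s\<^sup>2 = (\<Sum>k<Suc n. (cmod (u k))\<^sup>2)"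
    unfolding s_def by (intro real_sqrt_pow2 sum_nonneg) auto
  have sc: "s\<^sup>2 + (cmod c)\<^sup>2 = 1"
    using Suc.prems(4) unfolding s2 c_def by simp
  have v0: "Im (v 0) = 0" "Re (v 0) \<ge> 0"
    using Suc.prems(2,3) s0 by (auto simp: v_def complex_is_Real_iff)
  have v1: "(\<Sum>k<Suc n. (cmod (v k))\<^sup>2) = 1"
  proof (cases "s = 0")
    case True
    have "(\<Sum>k<Suc n. (cmod (v k))\<^sup>2) = (\<Sum>k<Suc n. if k = 0 then 1 else 0)"
      by (rule sum.cong) (auto simp: v_def True)
    then show ?thesis by (simp add: sum.delta)
  next
    case False
    have "(\<Sum>k<Suc n. (cmod (v k))\<^sup>2) = (\<Sum>k<Suc n. (cmod (u k))\<^sup>2 / s\<^sup>2)"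
      using False by (intro sum.cong) (auto simp: v_def norm_divide power_divide)
    also have "\<dots> = (\<Sum>k<Suc n. (cmod (u k))\<^sup>2) / s\<^sup>2"
      by (rule sum_divide_distrib[symmetric])
    also have "\<dots> = 1"
      using False by (simp only: s2[symmetric]) simp
    finally show ?thesis .
  qed
  have uv: "cnj (u k) = of_real s * cnj (v k)" if "k < Suc n" for k
  proof (cases "s = 0")
    case True
    then have "(\<Sum>k<Suc n. (cmod (u k))\<^sup>2) = 0"
      using s2 by simp
    then have "u k = 0"
      using that by (subst (asm) sum_nonneg_eq_0_iff) auto
    with True show ?thesis by simp
  qed (auto simp: v_def)
  have inner: "cinner (Suc n) u x = of_real s * cinner (Suc n) v x" for x
    unfolding cinner_def sum_distrib_left by (intro sum.cong) (auto simp: uv)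
  have upd: "cinner (Suc (Suc n)) u (x(Suc n := y)) = of_real s * cinner (Suc n) v x + cnj c * y" for x y
    by (simp add: cinner_Suc_upd inner c_def)
  \<comment> \<open>With \<open>z\<close> the component of the shorter vector along \<open>v\<close>
    and \<open>y\<close> the new entry, the component along \<open>u\<close> is one coordinate of
    the rotated pair \<open>(z, y)\<close>, and the other coordinate joins the residual.\<close>
  have res: "R + (cmod y)\<^sup>2 - (cmod (of_real s * z + cnj c * y))\<^sup>2
      = R - (cmod z)\<^sup>2 + (cmod (of_real s * y - c * z))\<^sup>2" for R z y
    using norm_unitary2[OF sc, of z y] by simp
  have sum_upd: "(\<Sum>k<Suc m. (cmod ((x(m := y)) k))\<^sup>2) = (\<Sum>k<m. (cmod (x k))\<^sup>2) + (cmod y)\<^sup>2"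
    for x and y :: complex and m :: nat
    by simp
  \<comment> \<open>The new entry is integrated out inside the test function, so the induction
    hypothesis applies to \<open>F'\<close>; hence the induction over arbitrary
    \<open>F\<close>.\<close>
  define F' where "F' = (\<lambda>z r. \<integral>\<^sup>+y. F (of_real s * z + cnj c * y) (r + (cmod (of_real s * y - c * z))\<^sup>2) \<partial>CN_std)"
  have [measurable]: "case_prod F' \<in> borel_measurable (borel \<Otimes>\<^sub>M borel)"
    unfolding F'_def by measurable
  have "(\<integral>\<^sup>+h. F (cinner (Suc (Suc n)) u h)
            ((\<Sum>k<Suc (Suc n). (cmod (h k))\<^sup>2) - (cmod (cinner (Suc (Suc n)) u h))\<^sup>2) \<partial>CN_vec (Suc (Suc n)))
     = (\<integral>\<^sup>+h. F' (cinner (Suc n) v h)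
            ((\<Sum>k<Suc n. (cmod (h k))\<^sup>2) - (cmod (cinner (Suc n) v h))\<^sup>2) \<partial>CN_vec (Suc n))"
    apply (subst nn_integral_CN_vec_Suc)
     apply measurable
    unfolding upd sum_upd res F'_def ..
  also have "\<dots> = (\<integral>\<^sup>+a. \<integral>\<^sup>+h. F' a (\<Sum>k<n. (cmod (h k))\<^sup>2) \<partial>CN_vec n \<partial>CN_std)"
    by (rule Suc.IH[OF _ v0 v1]) measurable
  \<comment> \<open>The swap brings the integrals over \<open>a\<close> and \<open>y\<close>
    together, so that the rotation of this pair can be undone with \<open>h\<close> held
    fixed.\<close>
  also have "\<dots> = (\<integral>\<^sup>+h. \<integral>\<^sup>+a. F' a (\<Sum>k<n. (cmod (h k))\<^sup>2) \<partial>CN_std \<partial>CN_vec n)"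
    by (rule P.Fubini'[symmetric]) measurable
  also have "\<dots> = (\<integral>\<^sup>+h. \<integral>\<^sup>+a. \<integral>\<^sup>+y. F a ((\<Sum>k<n. (cmod (h k))\<^sup>2) + (cmod y)\<^sup>2) \<partial>CN_std \<partial>CN_std \<partial>CN_vec n)"
    unfolding F'_def
    by (intro nn_integral_cong nn_integral_CN_std_unitary[OF _ s0 sc, where f="\<lambda>a y. F a (_ + (cmod y)\<^sup>2)"]) measurable
  also have "\<dots> = (\<integral>\<^sup>+a. \<integral>\<^sup>+h. \<integral>\<^sup>+y. F a ((\<Sum>k<n. (cmod (h k))\<^sup>2) + (cmod y)\<^sup>2) \<partial>CN_std \<partial>CN_vec n \<partial>CN_std)"
    by (rule P.Fubini') measurable
  also have "\<dots> = (\<integral>\<^sup>+a. \<integral>\<^sup>+h. F a (\<Sum>k<Suc n. (cmod (h k))\<^sup>2) \<partial>CN_vec (Suc n) \<partial>CN_std)"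
  proof (rule nn_integral_cong)
    fix a
    have "(\<lambda>h. F a (\<Sum>k<Suc n. (cmod (h k))\<^sup>2)) \<in> borel_measurable (CN_vec (Suc n))"
      by measurable
    then show "(\<integral>\<^sup>+h. \<integral>\<^sup>+y. F a ((\<Sum>k<n. (cmod (h k))\<^sup>2) + (cmod y)\<^sup>2) \<partial>CN_std \<partial>CN_vec n)
        = (\<integral>\<^sup>+h. F a (\<Sum>k<Suc n. (cmod (h k))\<^sup>2) \<partial>CN_vec (Suc n))"
      by (simp only: nn_integral_CN_vec_Suc sum_upd)
  qed
  finally show ?case .
qed

lemma vnorm_square: "(vnorm n g)\<^sup>2 = (\<Sum>k<n. (cmod (g k))\<^sup>2)"
  unfolding vnorm_def by (intro real_sqrt_pow2 sum_nonneg) auto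

lemma vnorm_nonneg[simp]: "vnorm n g \<ge> 0"
  unfolding vnorm_def by (intro real_sqrt_ge_zero sum_nonneg) auto

text \<open>Squared moduli ignore the phase of the direction, and dividing by the norm makes it a
  unit vector. A test function of the first argument alone gives the interference law, one of the
  second alone the zero-forcing signal law.\<close>

lemma nn_integral_CN_vec_projection_norm:
  fixes F :: "real \<Rightarrow> real \<Rightarrow> ennreal"
  assumes [measurable]: "case_prod F \<in> borel_measurable (borel \<Otimes>\<^sub>M borel)"
    and g: "vnorm (Suc n) g \<noteq> 0"
  shows "(\<integral>\<^sup>+h. F ((cmod (cinner (Suc n) g h))\<^sup>2 / (vnorm (Suc n) g)\<^sup>2)
            ((vnorm (Suc n) h)\<^sup>2 - (cmod (cinner (Suc n) g h))\<^sup>2 / (vnorm (Suc n) g)\<^sup>2) \<partial>CN_vec (Suc n))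
       = (\<integral>\<^sup>+a. \<integral>\<^sup>+h. F ((cmod a)\<^sup>2) ((vnorm n h)\<^sup>2) \<partial>CN_vec n \<partial>CN_std)"
proof -
  \<comment> \<open>a global phase makes the first entry of the direction a nonnegative real\<close>
  define e where "e = (if g 0 = 0 then 1 else cnj (g 0) / of_real (cmod (g 0)))"
  define r where "r = vnorm (Suc n) g"
  define u where "u = (\<lambda>k. e * g k / of_real r)"
  have r: "r > 0"
    using g vnorm_nonneg[of "Suc n" g] unfolding r_def by linarith
  have e: "cmod e = 1"
    by (auto simp: e_def norm_divide)
  have "e * g 0 = of_real (cmod (g 0))"
    by (auto simp: e_def complex_norm_square[symmetric] power2_eq_square field_simps)
  then have u0: "u 0 = of_real (cmod (g 0) / r)"
    by (simp add: u_def)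
  have "(\<Sum>k<Suc n. (cmod (u k))\<^sup>2) = (\<Sum>k<Suc n. (cmod (g k))\<^sup>2 / r\<^sup>2)"
    using r by (intro sum.cong) (auto simp: u_def norm_mult norm_divide e power_divide)
  also have "\<dots> = (vnorm (Suc n) g)\<^sup>2 / r\<^sup>2"
    by (simp only: vnorm_square sum_divide_distrib)
  also have "\<dots> = 1"
    using r by (simp add: r_def)
  finally have u1: "(\<Sum>k<Suc n. (cmod (u k))\<^sup>2) = 1" .
  have "cinner (Suc n) u h = cnj e / of_real r * cinner (Suc n) g h" for h
    unfolding cinner_def sum_distrib_left by (intro sum.cong) (auto simp: u_def)
  then have inner: "(cmod (cinner (Suc n) g h))\<^sup>2 / (vnorm (Suc n) g)\<^sup>2 = (cmod (cinner (Suc n) u h))\<^sup>2" for h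
    using r by (simp add: norm_mult norm_divide e r_def power_divide)
  show ?thesis
    unfolding inner unfolding vnorm_square
    by (rule nn_integral_CN_vec_projection[where F="\<lambda>a x. F ((cmod a)\<^sup>2) x"])
       (use u0 r u1 in auto)
qed

subsection \<open>Expected logarithms of Erlang variables\<close>

lemma nn_integral_power_exp:
  fixes b :: real
  assumes b: "b > 0"
  shows "(\<integral>\<^sup>+t. ennreal (t ^ i * exp (- b * t)) * indicator {0<..} t \<partial>lborel) = ennreal (fact i / b ^ Suc i)"
proof -
  have "(\<integral>\<^sup>+t. ennreal (t ^ i * exp (- b * t)) * indicator {0<..} t \<partial>lborel)
      = (\<integral>\<^sup>+t. ennreal (1 / b) * ennreal (erlang_density 0 b t * t ^ i) \<partial>lborel)"
  proof (rule nn_integral_cong_AE)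
    show "AE t in lborel. ennreal (t ^ i * exp (- b * t)) * indicator {0<..} t
        = ennreal (1 / b) * ennreal (erlang_density 0 b t * t ^ i)"
      using AE_lborel_singleton[of 0]
      by eventually_elim
         (use b in \<open>auto simp: erlang_density_def ennreal_mult[symmetric] mult.commute split: split_indicator\<close>)
  qed
  also have "\<dots> = ennreal (1 / b) * ennreal (fact i / b ^ i)"
    using nn_integral_erlang_ith_moment[OF b, of 0 i] by (simp add: nn_integral_cmult)
  also have "\<dots> = ennreal (fact i / b ^ Suc i)"
    using b by (simp add: ennreal_mult[symmetric])
  finally show ?thesis .
qed

text \<open>The open interval is chosen so that, for \<open>S = c * x\<close>, its indicator is
  exactly the product of those of \<open>t > 0\<close> and \<open>x > t / c\<close>.\<close>

lemma ln_one_plus_eq_nn_integral: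
  fixes S :: real
  assumes S: "S \<ge> 0"
  shows "ennreal (ln (1 + S)) = (\<integral>\<^sup>+t. ennreal (1 / (1 + t)) * indicator {0<..<S} t \<partial>lborel)"
proof -
  have "(\<integral>\<^sup>+t. ennreal (1 / (1 + t)) * indicator {0<..<S} t \<partial>lborel)
      = (\<integral>\<^sup>+t. ennreal (1 / (1 + t)) * indicator {0..S} t \<partial>lborel)"
  proof (rule nn_integral_cong_AE)
    show "AE t in lborel. ennreal (1 / (1 + t)) * indicator {0<..<S} t = ennreal (1 / (1 + t)) * indicator {0..S} t"
      using AE_lborel_singleton[of 0] AE_lborel_singleton[of S]
      by eventually_elim (auto split: split_indicator)
  qed
  also have "\<dots> = ennreal (ln (1 + S) - ln (1 + 0))"
    using S by (intro nn_integral_FTC_Icc) (auto intro!: derivative_eq_intros)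
  finally show ?thesis by simp
qed

text \<open>The sum is the probability that a Poisson variable of mean \<open>a\<close> is at most
  \<open>n\<close>. The index \<open>n\<close> belongs to a sum of \<open>n + 1\<close>
  exponentials, an offset that recurs as \<open>Suc n\<close> in the rates.\<close>

lemma erlang_density_tail:
  fixes a :: real
  assumes a: "a \<ge> 0"
  shows "(\<integral>\<^sup>+x. ennreal (erlang_density n 1 x) * indicator {a<..} x \<partial>lborel)
       = ennreal (\<Sum>i\<le>n. a ^ i * exp (- a) / fact i)"
proof -
  let ?D = "density lborel (\<lambda>x. ennreal (erlang_density n 1 x))"
  interpret D: prob_space ?D by (rule prob_space_erlang_density) simp
  have "(\<integral>\<^sup>+x. ennreal (erlang_density n 1 x) * indicator {a<..} x \<partial>lborel) = emeasure ?D {a<..}"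
    by (subst emeasure_density) auto
  also have "\<dots> = emeasure ?D (space ?D - {..a})"
    by (rule arg_cong[where f="emeasure ?D"]) auto
  also have "\<dots> = 1 - emeasure ?D {..a}"
    by (subst emeasure_compl) (use D.emeasure_space_1 in auto)
  also have "\<dots> = ennreal (1 - erlang_CDF n 1 a)"
    by (subst emeasure_erlang_density) (auto simp: ennreal_minus ennreal_1[symmetric] simp del: ennreal_1)
  also have "1 - erlang_CDF n 1 a = (\<Sum>i\<le>n. a ^ i * exp (- a) / fact i)"
    using a by (simp add: erlang_CDF_def)
  finally show ?thesis .
qed

lemma erlang_expectation_ln:
  fixes c :: real
  assumes c: "c > 0"
  shows "(\<integral>\<^sup>+x. ennreal (erlang_density n 1 x) * ennreal (ln (1 + c * x)) \<partial>lborel)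
       = (\<integral>\<^sup>+t. ennreal (1 / (1 + t)) * indicator {0<..} t
            * ennreal (\<Sum>i\<le>n. (t / c) ^ i * exp (- (t / c)) / fact i) \<partial>lborel)"
proof -
  have *: "ennreal (erlang_density n 1 x) * ennreal (ln (1 + c * x))
     = (\<integral>\<^sup>+t. ennreal (erlang_density n 1 x) * (ennreal (1 / (1 + t)) * indicator {0<..} t * indicator {t / c<..} x) \<partial>lborel)"
    for x
  proof (cases "x < 0")
    case True
    then show ?thesis by (simp add: erlang_density_def)
  next
    case False
    have "indicator {0<..<c * x} t = (indicator {0<..} t * indicator {t / c<..} x :: ennreal)" for t
      using c by (auto simp: field_simps split: split_indicator)
    then have ind: "ennreal (1 / (1 + t)) * indicator {0<..} t * indicator {t / c<..} x
        = ennreal (1 / (1 + t)) * indicator {0<..<c * x} t" for t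
      by (simp add: mult.assoc)
    show ?thesis
      unfolding ind using False c by (subst ln_one_plus_eq_nn_integral) (auto simp: nn_integral_cmult)
  qed
  have "(\<integral>\<^sup>+x. ennreal (erlang_density n 1 x) * ennreal (ln (1 + c * x)) \<partial>lborel)
     = (\<integral>\<^sup>+x. \<integral>\<^sup>+t. ennreal (erlang_density n 1 x)
          * (ennreal (1 / (1 + t)) * indicator {0<..} t * indicator {t / c<..} x) \<partial>lborel \<partial>lborel)"
    by (simp only: *)
  also have "\<dots> = (\<integral>\<^sup>+t. \<integral>\<^sup>+x. ennreal (erlang_density n 1 x)
          * (ennreal (1 / (1 + t)) * indicator {0<..} t * indicator {t / c<..} x) \<partial>lborel \<partial>lborel)"
    by (rule lborel_pair.Fubini') (simp add: greaterThan_def)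
  also have "\<dots> = (\<integral>\<^sup>+t. ennreal (1 / (1 + t)) * indicator {0<..} t
            * (\<integral>\<^sup>+x. ennreal (erlang_density n 1 x) * indicator {t / c<..} x \<partial>lborel) \<partial>lborel)"
    by (intro nn_integral_cong, subst nn_integral_cmult[symmetric]) (auto simp: ac_simps)
  also have "\<dots> = (\<integral>\<^sup>+t. ennreal (1 / (1 + t)) * indicator {0<..} t
            * ennreal (\<Sum>i\<le>n. (t / c) ^ i * exp (- (t / c)) / fact i) \<partial>lborel)"
    using c by (intro nn_integral_cong) (auto simp: erlang_density_tail split: split_indicator)
  finally show ?thesis .
qed

section \<open>Integral representations behind \<open>I1\<close> and the incomplete gamma
  function\<close>

lemma nn_integral_exp_tail:
  fixes b :: real
  assumes "b > 0"
  shows "(\<integral>\<^sup>+r. ennreal (exp (- b * r)) * indicator {0<..} r \<partial>lborel) = ennreal (1 / b)"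
  using nn_integral_power_exp[OF assms, of 0] by simp

lemma nn_integral_I1:
  fixes a b :: real
  assumes a: "a > 0" and b: "b > 0"
  shows "(\<integral>\<^sup>+x. ennreal (x ^ m * exp (- a * x) / ((x + b) ^ n * (x + 1))) * indicator {0<..} x \<partial>lborel)
       = ennreal (I1 a b m n)"
proof -
  let ?f = "\<lambda>x. x ^ m * exp (- a * x) / ((x + b) ^ n * (x + 1))"
  \<comment> \<open>For positive \<open>x\<close> the denominator is at least \<open>b ^ n\<close>,
    so a gamma integral dominates. Finiteness matters: a real integral that diverges would be 0 by
    convention.\<close>
  have le: "?f x \<le> (1 / b ^ n) * (x ^ m * exp (- a * x))" if "x > 0" for x
  proof -
    have "b ^ n \<le> (x + b) ^ n * (x + 1)"
      using that b power_mono[of b "x + b" n] mult_mono[of "b ^ n" "(x + b) ^ n" 1 "x + 1"] by simp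
    then have "?f x \<le> x ^ m * exp (- a * x) / b ^ n"
      using that b by (intro divide_left_mono) auto
    then show ?thesis by simp
  qed
  have "(\<integral>\<^sup>+x. ennreal (?f x) * indicator {0<..} x \<partial>lborel)
     \<le> (\<integral>\<^sup>+x. ennreal (1 / b ^ n) * (ennreal (x ^ m * exp (- a * x)) * indicator {0<..} x) \<partial>lborel)"
    using le b by (intro nn_integral_mono) (auto simp: ennreal_mult[symmetric] simp del: times_divide_eq_left intro!: ennreal_leI split: split_indicator)
  also have "\<dots> < \<infinity>"
    using nn_integral_power_exp[OF a, of m]
    by (subst nn_integral_cmult) (auto simp: ennreal_mult_less_top)
  finally have fin: "(\<integral>\<^sup>+x. ennreal (?f x) * indicator {0<..} x \<partial>lborel) < \<infinity>" .
  have eq: "ennreal (?f x) * indicator {0<..} x = ennreal (indicator {0<..} x *\<^sub>R ?f x)" for x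
    by (auto split: split_indicator)
  have "(\<integral>\<^sup>+x. ennreal (indicator {0<..} x *\<^sub>R ?f x) \<partial>lborel)
      = ennreal (\<integral>x. indicator {0<..} x *\<^sub>R ?f x \<partial>lborel)"
  proof (rule nn_integral_eq_integral)
    show nn: "AE x in lborel. 0 \<le> indicator {0<..} x *\<^sub>R ?f x"
      using b by (auto split: split_indicator)
    show "integrable lborel (\<lambda>x. indicator {0<..} x *\<^sub>R ?f x)"
      using fin unfolding eq by (intro integrableI_nonneg nn) auto
  qed
  then show ?thesis
    unfolding eq I1_def set_lebesgue_integral_def .
qed

text \<open>Once \<open>1 / (1 + t)\<close> is an exponential integral in \<open>r\<close> and the
  order is swapped, the inner integral is \<open>fact i / (a + r) ^ Suc i\<close>. Substituting
  \<open>s = a + r\<close> turns \<open>exp (- r)\<close> into \<open>exp a * exp (- s)\<close> and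
  the range into \<open>s > a\<close>, which is the incomplete gamma integral.\<close>

lemma nn_integral_upper_inc_gamma:
  fixes a :: real
  assumes a: "a > 0"
  shows "(\<integral>\<^sup>+t. ennreal (t ^ i * exp (- a * t) / (1 + t)) * indicator {0<..} t \<partial>lborel)
       = ennreal (fact i * exp a * upper_inc_gamma (- real i) a)"
proof -
  let ?g = "\<lambda>s. s powr (- real i - 1) * exp (- s)"
  have gpow: "?g s = exp (- s) / s ^ Suc i" if "s > 0" for s
  proof -
    have "- real i - 1 = - real (Suc i)"
      by simp
    then have "s powr (- real i - 1) = s powr (- real (Suc i))"
      by (rule arg_cong)
    also have "\<dots> = 1 / s ^ Suc i"
      using that by (simp add: powr_minus powr_realpow divide_inverse del: power_Suc of_nat_Suc)
    finally show ?thesis by simp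
  qed
  have "(\<integral>\<^sup>+t. ennreal (t ^ i * exp (- a * t) / (1 + t)) * indicator {0<..} t \<partial>lborel)
     = (\<integral>\<^sup>+t. \<integral>\<^sup>+r. ennreal (t ^ i * exp (- (a + r) * t)) * indicator {0<..} t
          * (ennreal (exp (- r)) * indicator {0<..} r) \<partial>lborel \<partial>lborel)"
  proof (rule nn_integral_cong)
    fix t :: real
    show "ennreal (t ^ i * exp (- a * t) / (1 + t)) * indicator {0<..} t
       = (\<integral>\<^sup>+r. ennreal (t ^ i * exp (- (a + r) * t)) * indicator {0<..} t
          * (ennreal (exp (- r)) * indicator {0<..} r) \<partial>lborel)"
    proof (cases "t > 0")
      case True
      have "(\<integral>\<^sup>+r. ennreal (t ^ i * exp (- (a + r) * t)) * indicator {0<..} t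
          * (ennreal (exp (- r)) * indicator {0<..} r) \<partial>lborel)
        = (\<integral>\<^sup>+r. ennreal (t ^ i * exp (- a * t)) * (ennreal (exp (- (1 + t) * r)) * indicator {0<..} r) \<partial>lborel)"
        using True by (intro nn_integral_cong)
          (auto simp: ennreal_mult[symmetric] exp_add[symmetric] algebra_simps split: split_indicator)
      also have "\<dots> = ennreal (t ^ i * exp (- a * t)) * ennreal (1 / (1 + t))"
        using True nn_integral_exp_tail[of "1 + t"] by (subst nn_integral_cmult) auto
      finally show ?thesis
        using True by (simp add: ennreal_mult[symmetric])
    qed simp
  qed
  also have "\<dots> = (\<integral>\<^sup>+r. \<integral>\<^sup>+t. ennreal (t ^ i * exp (- (a + r) * t)) * indicator {0<..} t
          * (ennreal (exp (- r)) * indicator {0<..} r) \<partial>lborel \<partial>lborel)"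
    by (rule lborel_pair.Fubini'[symmetric]) measurable
  also have "\<dots> = (\<integral>\<^sup>+r. ennreal (fact i / (a + r) ^ Suc i) * (ennreal (exp (- r)) * indicator {0<..} r) \<partial>lborel)"
  proof (rule nn_integral_cong)
    fix r :: real
    show "(\<integral>\<^sup>+t. ennreal (t ^ i * exp (- (a + r) * t)) * indicator {0<..} t
          * (ennreal (exp (- r)) * indicator {0<..} r) \<partial>lborel)
        = ennreal (fact i / (a + r) ^ Suc i) * (ennreal (exp (- r)) * indicator {0<..} r)"
      using a nn_integral_power_exp[of "a + r" i]
      by (cases "r > 0") (simp_all add: nn_integral_multc)
  qed
  also have "\<dots> = (\<integral>\<^sup>+s. ennreal (fact i / s ^ Suc i) * (ennreal (exp (a - s)) * indicator {a<..} s) \<partial>lborel)"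
    by (subst nn_integral_real_affine[where c=1 and t="-a"])
       (auto intro!: nn_integral_cong split: split_indicator simp del: power_Suc)
  also have "\<dots> = (\<integral>\<^sup>+s. ennreal (fact i * exp a) * ennreal (indicator {a<..} s *\<^sub>R ?g s) \<partial>lborel)"
  proof (rule nn_integral_cong)
    fix s :: real
    have "fact i / s ^ Suc i * exp (a - s) = fact i * exp a * ?g s" if "s > a"
    proof -
      have "s > 0" using that a by simp
      show ?thesis
        unfolding gpow[OF \<open>s > 0\<close>] by (simp add: exp_diff exp_minus field_simps)
    qed
    then show "ennreal (fact i / s ^ Suc i) * (ennreal (exp (a - s)) * indicator {a<..} s)
        = ennreal (fact i * exp a) * ennreal (indicator {a<..} s *\<^sub>R ?g s)"
      using a by (cases "s > a") (simp_all add: ennreal_mult[symmetric] del: power_Suc)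
  qed
  also have "\<dots> = ennreal (fact i * exp a) * (\<integral>\<^sup>+s. ennreal (indicator {a<..} s *\<^sub>R ?g s) \<partial>lborel)"
    by (rule nn_integral_cmult) measurable
  also have "(\<integral>\<^sup>+s. ennreal (indicator {a<..} s *\<^sub>R ?g s) \<partial>lborel)
      = ennreal (\<integral>s. indicator {a<..} s *\<^sub>R ?g s \<partial>lborel)"
  proof (rule nn_integral_eq_integral)
    show nn: "AE s in lborel. 0 \<le> indicator {a<..} s *\<^sub>R ?g s"
      by (auto split: split_indicator)
    \<comment> \<open>On \<open>s > a\<close> the power is at most \<open>1 / a ^ Suc i\<close>, so
      an exponential dominates and the real integral exists.\<close>
    have "(\<integral>\<^sup>+s. ennreal (indicator {a<..} s *\<^sub>R ?g s) \<partial>lborel)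
       \<le> (\<integral>\<^sup>+s. ennreal (1 / a ^ Suc i) * (ennreal (exp (- 1 * s)) * indicator {0<..} s) \<partial>lborel)"
      using a by (intro nn_integral_mono)
        (auto simp: gpow ennreal_mult[symmetric] simp del: power_Suc intro!: ennreal_leI divide_left_mono power_mono mult_pos_pos split: split_indicator)
    also have "\<dots> < \<infinity>"
      using nn_integral_exp_tail[of 1] by (subst nn_integral_cmult) (auto simp: ennreal_mult_less_top)
    finally show "integrable lborel (\<lambda>s. indicator {a<..} s *\<^sub>R ?g s)"
      by (intro integrableI_nonneg nn) auto
  qed
  finally show ?thesis
    by (simp add: upper_inc_gamma_def set_lebesgue_integral_def ennreal_mult')
qed

lemma upper_inc_gamma_nonneg: "upper_inc_gamma s x \<ge> 0"
  unfolding upper_inc_gamma_def set_lebesgue_integral_def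
  by (intro Bochner_Integration.integral_nonneg) (auto split: split_indicator)

lemma I1_nonneg: "b > 0 \<Longrightarrow> I1 a b m n \<ge> 0"
  unfolding I1_def set_lebesgue_integral_def
  by (intro Bochner_Integration.integral_nonneg) (auto split: split_indicator)

lemma R_BF_nonneg: "\<gamma> > 0 \<Longrightarrow> R_BF \<gamma> M \<ge> 0"
  unfolding R_BF_def
  by (intro mult_nonneg_nonneg sum_nonneg divide_nonneg_nonneg) (auto simp: upper_inc_gamma_nonneg log_def)

lemma R_I2_nonneg: "\<gamma>1 > 0 \<Longrightarrow> \<gamma>2 > 0 \<Longrightarrow> R_I2 \<gamma>1 \<gamma>2 M \<ge> 0"
  unfolding R_I2_def
  by (intro mult_nonneg_nonneg sum_nonneg divide_nonneg_nonneg) (auto simp: I1_nonneg log_def)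

section \<open>Expected rates without and with exponential interference\<close>

lemma erlang_expectation_log:
  fixes c :: real
  assumes c: "c > 0"
  shows "(\<integral>\<^sup>+x. ennreal (erlang_density n 1 x) * ennreal (log 2 (1 + c * x)) \<partial>lborel)
       = ennreal (1 / ln 2) * (\<integral>\<^sup>+t. ennreal (1 / (1 + t)) * indicator {0<..} t
            * ennreal (\<Sum>i\<le>n. (t / c) ^ i * exp (- (t / c)) / fact i) \<partial>lborel)"
proof -
  have "ennreal (log 2 y) = ennreal (1 / ln 2) * ennreal (ln y)" for y
    by (simp add: log_def ennreal_mult'[symmetric])
  then have "(\<integral>\<^sup>+x. ennreal (erlang_density n 1 x) * ennreal (log 2 (1 + c * x)) \<partial>lborel)
     = (\<integral>\<^sup>+x. ennreal (1 / ln 2) * (ennreal (erlang_density n 1 x) * ennreal (ln (1 + c * x))) \<partial>lborel)"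
    by (simp only: mult.left_commute)
  also have "\<dots> = ennreal (1 / ln 2) * (\<integral>\<^sup>+x. ennreal (erlang_density n 1 x) * ennreal (ln (1 + c * x)) \<partial>lborel)"
    by (rule nn_integral_cmult) measurable
  finally show ?thesis
    by (simp only: erlang_expectation_ln[OF c])
qed

text \<open>The \<open>i\<close>-th term of the Erlang tail carries \<open>1 / fact i\<close>, which
  cancels the \<open>fact i\<close> of the incomplete gamma integral.\<close>

lemma erlang_expectation_log_R_BF:
  fixes \<gamma> :: real
  assumes \<gamma>: "\<gamma> > 0"
  shows "(\<integral>\<^sup>+x. ennreal (erlang_density n 1 x) * ennreal (log 2 (1 + \<gamma> * x)) \<partial>lborel)
       = ennreal (R_BF \<gamma> (Suc n))"
proof -
  have "(\<integral>\<^sup>+t. ennreal (1 / (1 + t)) * indicator {0<..} t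
            * ennreal (\<Sum>i\<le>n. (t / \<gamma>) ^ i * exp (- (t / \<gamma>)) / fact i) \<partial>lborel)
      = (\<integral>\<^sup>+t. (\<Sum>i\<le>n. ennreal ((1 / \<gamma>) ^ i / fact i)
          * (ennreal (t ^ i * exp (- (1 / \<gamma>) * t) / (1 + t)) * indicator {0<..} t)) \<partial>lborel)"
    using \<gamma> by (intro nn_integral_cong)
      (auto simp: ennreal_mult[symmetric] sum_ennreal sum_nonneg sum_distrib_left power_divide
        split: split_indicator intro!: arg_cong[where f=ennreal] sum.cong)
  also have "\<dots> = (\<Sum>i\<le>n. ennreal ((1 / \<gamma>) ^ i / fact i)
      * ennreal (fact i * exp (1 / \<gamma>) * upper_inc_gamma (- real i) (1 / \<gamma>)))"
    using \<gamma> nn_integral_upper_inc_gamma[of "1 / \<gamma>"] by (simp add: nn_integral_sum nn_integral_cmult)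
  also have "\<dots> = ennreal (\<Sum>i\<le>n. exp (1 / \<gamma>) * (upper_inc_gamma (- real i) (1 / \<gamma>) / \<gamma> ^ i))"
    using \<gamma> by (subst sum_ennreal[symmetric])
      (auto simp: upper_inc_gamma_nonneg ennreal_mult[symmetric] power_divide intro!: sum.cong)
  finally show ?thesis
    using \<gamma> unfolding erlang_expectation_log[OF \<gamma>]
    by (simp add: ennreal_mult'[symmetric] R_BF_def log_def lessThan_Suc_atMost sum_distrib_left mult.assoc)
qed

text \<open>Averages one term of the conditional Erlang tail over the interference power
  \<open>y\<close>; it is applied with \<open>a = t * \<gamma>2 / \<gamma>1\<close>. The binomial
  theorem reduces it to gamma integrals with rate \<open>1 + a\<close>.\<close>

lemma exponential_expectation_affine_power:
  fixes \<gamma> a :: real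
  assumes \<gamma>: "\<gamma> > 0" and a: "a > 0"
  shows "(\<integral>\<^sup>+y. ennreal (exponential_density 1 y) * ennreal ((1 + \<gamma> * y) ^ i * exp (- a * y)) \<partial>lborel)
       = ennreal (\<Sum>l\<le>i. real (i choose l) * \<gamma> ^ l * fact l / (1 + a) ^ Suc l)"
proof -
  have "(\<integral>\<^sup>+y. ennreal (exponential_density 1 y) * ennreal ((1 + \<gamma> * y) ^ i * exp (- a * y)) \<partial>lborel)
     = (\<integral>\<^sup>+y. (\<Sum>l\<le>i. ennreal (real (i choose l) * \<gamma> ^ l)
         * (ennreal (y ^ l * exp (- (1 + a) * y)) * indicator {0<..} y)) \<partial>lborel)"
  proof (rule nn_integral_cong_AE)
    show "AE y in lborel. ennreal (exponential_density 1 y) * ennreal ((1 + \<gamma> * y) ^ i * exp (- a * y))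
      = (\<Sum>l\<le>i. ennreal (real (i choose l) * \<gamma> ^ l)
         * (ennreal (y ^ l * exp (- (1 + a) * y)) * indicator {0<..} y))"
      using AE_lborel_singleton[of 0]
    proof eventually_elim
      case (elim y)
      show ?case
      proof (cases "y > 0")
        case True
        have "exp (- y) * ((1 + \<gamma> * y) ^ i * exp (- a * y))
          = (\<Sum>l\<le>i. real (i choose l) * \<gamma> ^ l * (y ^ l * exp (- (1 + a) * y)))"
          using binomial_ring[of "\<gamma> * y" 1 i]
          by (simp add: add.commute sum_distrib_left sum_distrib_right power_mult_distrib
              exp_add exp_diff exp_minus algebra_simps divide_inverse)
        then show ?thesis
          using True \<gamma> by (simp add: exponential_density_def ennreal_mult[symmetric] sum_ennreal)
      qed (use elim in \<open>auto simp: exponential_density_def\<close>)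
    qed
  qed
  also have "\<dots> = (\<Sum>l\<le>i. ennreal (real (i choose l) * \<gamma> ^ l) * ennreal (fact l / (1 + a) ^ Suc l))"
    using a nn_integral_power_exp[of "1 + a"] by (simp add: nn_integral_sum nn_integral_cmult del: power_Suc)
  also have "\<dots> = ennreal (\<Sum>l\<le>i. real (i choose l) * \<gamma> ^ l * fact l / (1 + a) ^ Suc l)"
    using a \<gamma> by (subst sum_ennreal[symmetric]) (auto simp: ennreal_mult[symmetric])
  finally show ?thesis .
qed

text \<open>The \<open>l + 1\<close> factors
  \<open>1 + t * g2 / g1 = (g2 / g1) * (t + g1 / g2)\<close> contribute
  \<open>(g1 / g2) ^ (l + 1)\<close>, which meets \<open>g2 ^ l\<close> and \<open>g1 ^ i\<close> to
  give the single \<open>1 / g2\<close> and the possibly negative exponent \<open>l + 1 - i\<close>.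
  The binomial coefficient times \<open>fact l / fact i\<close> is
  \<open>1 / fact (i - l)\<close>.\<close>

lemma R_I2_coefficient:
  fixes g1 g2 t :: real
  assumes g: "g1 > 0" "g2 > 0" and t: "t > 0" and l: "l \<le> i"
  shows "(t / g1) ^ i * exp (- (t / g1)) / fact i / (1 + t)
       * (real (i choose l) * g2 ^ l * fact l / (1 + t * g2 / g1) ^ Suc l)
     = g1 powi (int l + 1 - int i) / (g2 * fact (i - l))
       * (t ^ i * exp (- (1 / g1) * t) / ((t + g1 / g2) ^ (l + 1) * (t + 1)))"
proof -
  have 1: "real (i choose l) * fact l / fact i = 1 / fact (i - l)"
    using binomial_fact[OF l, where 'a=real] by (simp add: field_simps)
  have 2: "1 + t * g2 / g1 = (g2 / g1) * (t + g1 / g2)"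
    using g by (simp add: field_simps)
  have 3: "g1 powi (int l + 1 - int i) = g1 ^ Suc l / g1 ^ i"
    using g by (simp add: power_int_diff power_int_add)
  have "(t / g1) ^ i * exp (- (t / g1)) / fact i / (1 + t)
       * (real (i choose l) * g2 ^ l * fact l / (1 + t * g2 / g1) ^ Suc l)
     = (real (i choose l) * fact l / fact i) * ((t / g1) ^ i * exp (- (t / g1))
       * g2 ^ l / (1 + t * g2 / g1) ^ Suc l / (1 + t))"
    by (simp add: mult.commute mult.left_commute)
  also have "\<dots> = g1 powi (int l + 1 - int i) / (g2 * fact (i - l))
       * (t ^ i * exp (- (1 / g1) * t) / ((t + g1 / g2) ^ (l + 1) * (t + 1)))"
    unfolding 1 2 3 using g t
    by (simp add: power_divide power_mult_distrib add.commute mult.commute mult.left_commute)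
  finally show ?thesis .
qed

text \<open>For fixed interference \<open>y\<close> the signal is an Erlang variable scaled by
  \<open>\<gamma>1 / (1 + \<gamma>2 * y)\<close>. Integrating over \<open>t\<close> first would
  leave incomplete gamma functions depending on \<open>y\<close>; integrating over \<open>y\<close>
  first is elementary and leaves the rational weights of \<open>I1\<close>.\<close>

lemma erlang_expectation_log_R_I2:
  fixes \<gamma>1 \<gamma>2 :: real
  assumes g: "\<gamma>1 > 0" "\<gamma>2 > 0"
  shows "(\<integral>\<^sup>+y. ennreal (exponential_density 1 y) *
          (\<integral>\<^sup>+x. ennreal (erlang_density n 1 x) * ennreal (log 2 (1 + \<gamma>1 * x / (1 + \<gamma>2 * y))) \<partial>lborel) \<partial>lborel)
       = ennreal (R_I2 \<gamma>1 \<gamma>2 (Suc n))"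
proof -
  let ?E = "\<lambda>t y i. (1 + \<gamma>2 * y) ^ i * exp (- (t * \<gamma>2 / \<gamma>1) * y)"
  let ?T = "\<lambda>t i. (t / \<gamma>1) ^ i * exp (- (t / \<gamma>1)) / fact i"
  let ?B = "\<lambda>t i l. real (i choose l) * \<gamma>2 ^ l * fact l / (1 + t * \<gamma>2 / \<gamma>1) ^ Suc l"
  let ?c = "\<lambda>i l. \<gamma>1 powi (int l + 1 - int i) / (\<gamma>2 * fact (i - l))"
  have 1: "ennreal (exponential_density 1 y) *
          (\<integral>\<^sup>+x. ennreal (erlang_density n 1 x) * ennreal (log 2 (1 + \<gamma>1 * x / (1 + \<gamma>2 * y))) \<partial>lborel)
      = ennreal (1 / ln 2) * (\<integral>\<^sup>+t. (\<Sum>i\<le>n. ennreal (?T t i / (1 + t)) * indicator {0<..} t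
            * (ennreal (exponential_density 1 y) * ennreal (?E t y i))) \<partial>lborel)" for y
  proof (cases "y < 0")
    case True
    then show ?thesis by (simp add: exponential_density_def)
  next
    case False
    then have c: "\<gamma>1 / (1 + \<gamma>2 * y) > 0"
      using g by (simp add: add_pos_nonneg)
    have T: "(t / (\<gamma>1 / (1 + \<gamma>2 * y))) ^ i * exp (- (t / (\<gamma>1 / (1 + \<gamma>2 * y)))) / fact i
       = ?T t i * ?E t y i" for t i
    proof -
      have "t / (\<gamma>1 / (1 + \<gamma>2 * y)) = t / \<gamma>1 * (1 + \<gamma>2 * y)"
        by simp
      moreover have "exp (- (t / \<gamma>1 * (1 + \<gamma>2 * y))) = exp (- (t / \<gamma>1)) * exp (- (t * \<gamma>2 / \<gamma>1) * y)"
        by (simp add: exp_add[symmetric] algebra_simps)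
      ultimately show ?thesis
        by (simp only: power_mult_distrib) simp
    qed
    have "(\<integral>\<^sup>+x. ennreal (erlang_density n 1 x) * ennreal (log 2 (1 + \<gamma>1 * x / (1 + \<gamma>2 * y))) \<partial>lborel)
      = ennreal (1 / ln 2) * (\<integral>\<^sup>+t. ennreal (1 / (1 + t)) * indicator {0<..} t
            * ennreal (\<Sum>i\<le>n. ?T t i * ?E t y i) \<partial>lborel)"
      using erlang_expectation_log[OF c, of n] unfolding T by simp
    then have "ennreal (exponential_density 1 y) *
          (\<integral>\<^sup>+x. ennreal (erlang_density n 1 x) * ennreal (log 2 (1 + \<gamma>1 * x / (1 + \<gamma>2 * y))) \<partial>lborel)
      = ennreal (1 / ln 2) * (\<integral>\<^sup>+t. ennreal (exponential_density 1 y) * (ennreal (1 / (1 + t)) * indicator {0<..} t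
            * ennreal (\<Sum>i\<le>n. ?T t i * ?E t y i)) \<partial>lborel)"
      by (subst nn_integral_cmult) (auto simp: mult.left_commute)
    also have "(\<integral>\<^sup>+t. ennreal (exponential_density 1 y) * (ennreal (1 / (1 + t)) * indicator {0<..} t
            * ennreal (\<Sum>i\<le>n. ?T t i * ?E t y i)) \<partial>lborel)
       = (\<integral>\<^sup>+t. (\<Sum>i\<le>n. ennreal (?T t i / (1 + t)) * indicator {0<..} t
            * (ennreal (exponential_density 1 y) * ennreal (?E t y i))) \<partial>lborel)"
    proof (rule nn_integral_cong)
      fix t :: real
      show "ennreal (exponential_density 1 y) * (ennreal (1 / (1 + t)) * indicator {0<..} t
            * ennreal (\<Sum>i\<le>n. ?T t i * ?E t y i))
        = (\<Sum>i\<le>n. ennreal (?T t i / (1 + t)) * indicator {0<..} t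
            * (ennreal (exponential_density 1 y) * ennreal (?E t y i)))"
      proof (cases "t > 0")
        case True
        have nn: "?T t i \<ge> 0" "?E t y i \<ge> 0" for i
          using True False g by auto
        have "ennreal (exponential_density 1 y) * (ennreal (1 / (1 + t)) * ennreal (\<Sum>i\<le>n. ?T t i * ?E t y i))
          = (\<Sum>i\<le>n. ennreal (exponential_density 1 y) * (ennreal (1 / (1 + t)) * ennreal (?T t i * ?E t y i)))"
          using nn by (subst sum_ennreal[symmetric]) (simp_all only: sum_distrib_left mult_nonneg_nonneg)
        also have "\<dots> = (\<Sum>i\<le>n. ennreal (?T t i / (1 + t)) * (ennreal (exponential_density 1 y) * ennreal (?E t y i)))"
        proof (rule sum.cong[OF refl])
          fix i
          have "ennreal (?T t i / (1 + t)) = ennreal (1 / (1 + t)) * ennreal (?T t i)"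
            using True nn by (subst ennreal_mult[symmetric]) (auto simp: mult.commute)
          moreover have "ennreal (?T t i * ?E t y i) = ennreal (?T t i) * ennreal (?E t y i)"
            using nn by (intro ennreal_mult)
          ultimately show "ennreal (exponential_density 1 y) * (ennreal (1 / (1 + t)) * ennreal (?T t i * ?E t y i))
            = ennreal (?T t i / (1 + t)) * (ennreal (exponential_density 1 y) * ennreal (?E t y i))"
            by (simp only: ac_simps)
        qed
        finally show ?thesis using True by simp
      qed simp
    qed
    finally show ?thesis .
  qed
  have 2: "(\<integral>\<^sup>+y. (\<Sum>i\<le>n. ennreal (?T t i / (1 + t)) * indicator {0<..} t
            * (ennreal (exponential_density 1 y) * ennreal (?E t y i))) \<partial>lborel)
     = (\<Sum>i\<le>n. \<Sum>l\<le>i. ennreal (?c i l) *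
         (ennreal (t ^ i * exp (- (1 / \<gamma>1) * t) / ((t + \<gamma>1 / \<gamma>2) ^ (l + 1) * (t + 1))) * indicator {0<..} t))" for t
  proof (cases "t > 0")
    case True
    have a: "t * \<gamma>2 / \<gamma>1 > 0" using True g by simp
    have "(\<integral>\<^sup>+y. (\<Sum>i\<le>n. ennreal (?T t i / (1 + t)) * indicator {0<..} t
            * (ennreal (exponential_density 1 y) * ennreal (?E t y i))) \<partial>lborel)
      = (\<Sum>i\<le>n. ennreal (?T t i / (1 + t)) * (\<integral>\<^sup>+y. ennreal (exponential_density 1 y) * ennreal (?E t y i) \<partial>lborel))"
      using True by (subst nn_integral_sum) (auto simp: nn_integral_cmult)
    also have "\<dots> = (\<Sum>i\<le>n. ennreal (?T t i / (1 + t)) * ennreal (\<Sum>l\<le>i. ?B t i l))"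
      by (simp only: exponential_expectation_affine_power[OF g(2) a])
    also have "\<dots> = (\<Sum>i\<le>n. \<Sum>l\<le>i. ennreal (?c i l) *
         ennreal (t ^ i * exp (- (1 / \<gamma>1) * t) / ((t + \<gamma>1 / \<gamma>2) ^ (l + 1) * (t + 1))))"
    proof (rule sum.cong[OF refl])
      fix i
      have B: "?B t i l \<ge> 0" for l
        using True g by auto
      have T: "?T t i / (1 + t) \<ge> 0"
        using True g by auto
      have "ennreal (?T t i / (1 + t)) * ennreal (\<Sum>l\<le>i. ?B t i l)
         = (\<Sum>l\<le>i. ennreal (?T t i / (1 + t)) * ennreal (?B t i l))"
        using B by (subst sum_ennreal[symmetric]) (simp_all only: sum_distrib_left)
      also have "\<dots> = (\<Sum>l\<le>i. ennreal (?c i l) *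
         ennreal (t ^ i * exp (- (1 / \<gamma>1) * t) / ((t + \<gamma>1 / \<gamma>2) ^ (l + 1) * (t + 1))))"
      proof (rule sum.cong[OF refl])
        fix l assume "l \<in> {..i}"
        then have l: "l \<le> i" by simp
        have "?T t i / (1 + t) * ?B t i l = ?c i l *
           (t ^ i * exp (- (1 / \<gamma>1) * t) / ((t + \<gamma>1 / \<gamma>2) ^ (l + 1) * (t + 1)))"
          by (rule R_I2_coefficient[OF g True l])
        moreover have "?c i l \<ge> 0"
          using g by simp
        ultimately show "ennreal (?T t i / (1 + t)) * ennreal (?B t i l) = ennreal (?c i l) *
           ennreal (t ^ i * exp (- (1 / \<gamma>1) * t) / ((t + \<gamma>1 / \<gamma>2) ^ (l + 1) * (t + 1)))"
          by (simp only: ennreal_mult'[symmetric] T)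
      qed
      finally show "ennreal (?T t i / (1 + t)) * ennreal (\<Sum>l\<le>i. ?B t i l) = (\<Sum>l\<le>i. ennreal (?c i l) *
         ennreal (t ^ i * exp (- (1 / \<gamma>1) * t) / ((t + \<gamma>1 / \<gamma>2) ^ (l + 1) * (t + 1))))" .
    qed
    finally show ?thesis using True by simp
  qed simp
  have "(\<integral>\<^sup>+y. ennreal (exponential_density 1 y) *
          (\<integral>\<^sup>+x. ennreal (erlang_density n 1 x) * ennreal (log 2 (1 + \<gamma>1 * x / (1 + \<gamma>2 * y))) \<partial>lborel) \<partial>lborel)
     = ennreal (1 / ln 2) * (\<integral>\<^sup>+y. \<integral>\<^sup>+t. (\<Sum>i\<le>n. ennreal (?T t i / (1 + t)) * indicator {0<..} t
            * (ennreal (exponential_density 1 y) * ennreal (?E t y i))) \<partial>lborel \<partial>lborel)"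
    unfolding 1 by (rule nn_integral_cmult) measurable
  also have "(\<integral>\<^sup>+y. \<integral>\<^sup>+t. (\<Sum>i\<le>n. ennreal (?T t i / (1 + t)) * indicator {0<..} t
            * (ennreal (exponential_density 1 y) * ennreal (?E t y i))) \<partial>lborel \<partial>lborel)
     = (\<integral>\<^sup>+t. \<integral>\<^sup>+y. (\<Sum>i\<le>n. ennreal (?T t i / (1 + t)) * indicator {0<..} t
            * (ennreal (exponential_density 1 y) * ennreal (?E t y i))) \<partial>lborel \<partial>lborel)"
    by (rule lborel_pair.Fubini') measurable
  also have "\<dots> = (\<Sum>i\<le>n. \<Sum>l\<le>i. ennreal (?c i l) * ennreal (I1 (1 / \<gamma>1) (\<gamma>1 / \<gamma>2) i (l + 1)))"
    unfolding 2 using g nn_integral_I1[of "1 / \<gamma>1" "\<gamma>1 / \<gamma>2"]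
    by (simp add: nn_integral_sum nn_integral_cmult del: power_Suc)
  also have "\<dots> = ennreal (\<Sum>i\<le>n. \<Sum>l\<le>i. ?c i l * I1 (1 / \<gamma>1) (\<gamma>1 / \<gamma>2) i (l + 1))"
    using g by (simp add: sum_ennreal ennreal_mult'[symmetric] sum_nonneg I1_nonneg)
  also have "ennreal (1 / ln 2) * \<dots> = ennreal (R_I2 \<gamma>1 \<gamma>2 (Suc n))"
    by (simp add: ennreal_mult'[symmetric] R_I2_def log_def lessThan_Suc_atMost)
  finally show ?thesis .
qed

subsection \<open>Gains of the precoders\<close>

text \<open>A sum of \<open>Suc n\<close> independent exponentials of rate 1 is Erlang with index
  \<open>n\<close>.\<close>

lemma distributed_CN_vec_vnorm_square:
  "distributed (CN_vec (Suc n)) lborel (\<lambda>h. (vnorm (Suc n) h)\<^sup>2) (erlang_density n 1)"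
proof -
  interpret V: prob_space "CN_vec (Suc n)" by (rule prob_space_CN_vec)
  have coord: "distr (CN_vec (Suc n)) CN_std (\<lambda>h. h k) = CN_std" if "k < Suc n" for k
    using that distr_PiM_component[of "{..<Suc n}" "\<lambda>_. CN_std" k] prob_space_CN_std by simp
  \<comment> \<open>On the product space the restricted coordinate map is the identity, so the joint
    law is the product of the marginals, which is independence.\<close>
  have "V.indep_vars (\<lambda>_. CN_std) (\<lambda>k h. h k) {..<Suc n}"
  proof (subst V.indep_vars_iff_distr_eq_PiM')
    have "distr (CN_vec (Suc n)) (CN_vec (Suc n)) (\<lambda>h. \<lambda>k\<in>{..<Suc n}. h k)
        = distr (CN_vec (Suc n)) (CN_vec (Suc n)) (\<lambda>h. h)"
      by (rule distr_cong) (simp_all only: space_PiM restrict_PiE_iff PiE_restrict)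
    also have "\<dots> = CN_vec (Suc n)"
      by (rule distr_id)
    also have "\<dots> = PiM {..<Suc n} (\<lambda>k. distr (CN_vec (Suc n)) CN_std (\<lambda>h. h k))"
      by (rule PiM_cong) (simp_all only: coord lessThan_iff)
    finally show "distr (CN_vec (Suc n)) (CN_vec (Suc n)) (\<lambda>h. \<lambda>k\<in>{..<Suc n}. h k)
        = PiM {..<Suc n} (\<lambda>k. distr (CN_vec (Suc n)) CN_std (\<lambda>h. h k))" .
  qed (auto intro: measurable_component_singleton)
  then have "V.indep_vars (\<lambda>_. borel) (\<lambda>k h. (cmod (h k))\<^sup>2) {..<Suc n}"
    by (rule V.indep_vars_compose2) measurable
  moreover have "distributed (CN_vec (Suc n)) lborel (\<lambda>h. (cmod (h k))\<^sup>2) (exponential_density 1)" if "k < Suc n" for k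
  proof -
    have [measurable]: "(\<lambda>h. h k) \<in> measurable (CN_vec (Suc n)) CN_std"
      using that by (intro measurable_component_singleton) auto
    have "distr (CN_vec (Suc n)) borel (\<lambda>h. (cmod (h k))\<^sup>2)
        = distr (distr (CN_vec (Suc n)) CN_std (\<lambda>h. h k)) borel (\<lambda>z. (cmod z)\<^sup>2)"
      by (subst distr_distr) (auto simp: comp_def)
    also have "\<dots> = density lborel (exponential_density 1)"
      using coord[OF that] distr_CN_std_norm_square by simp
    finally have "distr (CN_vec (Suc n)) lborel (\<lambda>h. (cmod (h k))\<^sup>2) = density lborel (exponential_density 1)"
      by (simp cong: distr_cong)
    moreover have "(\<lambda>h. (cmod (h k))\<^sup>2) \<in> borel_measurable (CN_vec (Suc n))"
      using that by simp
    ultimately show ?thesis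
      unfolding distributed_def by auto
  qed
  ultimately have "distributed (CN_vec (Suc n)) lborel (\<lambda>h. \<Sum>k<Suc n. (cmod (h k))\<^sup>2)
      (erlang_density (card {..<Suc n} - 1) 1)"
    by (intro V.exponential_distributed_sum) auto
  then show ?thesis
    by (simp only: vnorm_square card_lessThan diff_Suc_1)
qed

lemma nn_integral_CN_vec_vnorm_square:
  assumes "f \<in> borel_measurable borel"
  shows "(\<integral>\<^sup>+h. f ((vnorm (Suc n) h)\<^sup>2) \<partial>CN_vec (Suc n))
       = (\<integral>\<^sup>+x. ennreal (erlang_density n 1 x) * f x \<partial>lborel)"
  using distributed_nn_integral[OF distributed_CN_vec_vnorm_square, of f n] assms by simp

lemma nn_integral_CN_std_norm_square:
  assumes [measurable]: "f \<in> borel_measurable borel"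
  shows "(\<integral>\<^sup>+z. f ((cmod z)\<^sup>2) \<partial>CN_std) = (\<integral>\<^sup>+y. ennreal (exponential_density 1 y) * f y \<partial>lborel)"
proof -
  have "(\<integral>\<^sup>+z. f ((cmod z)\<^sup>2) \<partial>CN_std) = (\<integral>\<^sup>+y. f y \<partial>distr CN_std borel (\<lambda>z. (cmod z)\<^sup>2))"
    by (rule nn_integral_distr[symmetric]) measurable
  also have "\<dots> = (\<integral>\<^sup>+y. ennreal (exponential_density 1 y) * f y \<partial>lborel)"
    unfolding distr_CN_std_norm_square by (rule nn_integral_density) measurable
  finally show ?thesis .
qed

text \<open>The Erlang law has no atom at 0. This discards the zero directions, which the projection
  law excludes.\<close>

lemma AE_CN_vec_vnorm_neq_0: "AE h in CN_vec (Suc n). vnorm (Suc n) h \<noteq> 0"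
proof -
  interpret V: prob_space "CN_vec (Suc n)" by (rule prob_space_CN_vec)
  have "AE x in lborel. 0 < erlang_density n 1 x \<longrightarrow> x \<noteq> 0"
    using AE_lborel_singleton[of "0::real"] by eventually_elim auto
  then have "AE h in CN_vec (Suc n). (vnorm (Suc n) h)\<^sup>2 \<noteq> 0"
    by (subst V.distributed_AE2[OF distributed_CN_vec_vnorm_square]) auto
  then show ?thesis by simp
qed

section \<open>Inner products with the two precoders\<close>

lemma cinner_self: "cinner n h h = of_real ((vnorm n h)\<^sup>2)"
  unfolding cinner_def vnorm_square of_real_sum
  by (intro sum.cong) (auto simp: complex_norm_square mult.commute simp flip: of_real_power)

lemma cinner_bf_prec: "(cmod (cinner n h (bf_prec n h)))\<^sup>2 = (vnorm n h)\<^sup>2"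
proof -
  have "cinner n h (bf_prec n h) = cinner n h h / of_real (vnorm n h)"
    by (simp add: cinner_def bf_prec_def sum_divide_distrib)
  then have "cinner n h (bf_prec n h) = of_real (vnorm n h)"
    by (simp add: cinner_self power2_eq_square)
  then show ?thesis by simp
qed

text \<open>Exchanges the roles: the serving channel \<open>h\<close> becomes the direction and
  \<open>g\<close> the Gaussian vector projected on it.\<close>

lemma cinner_bf_prec_other:
  "(cmod (cinner n g (bf_prec n h)))\<^sup>2 = (cmod (cinner n h g))\<^sup>2 / (vnorm n h)\<^sup>2"
proof -
  have "cinner n g (bf_prec n h) = cnj (cinner n h g) / of_real (vnorm n h)"
    by (simp add: cinner_def bf_prec_def sum_divide_distrib mult.commute)
  then show ?thesis by (simp add: norm_divide power_divide)
qed

lemma cinner_diff_right: "cinner n x (\<lambda>k. y k - z k) = cinner n x y - cinner n x z"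
  by (simp add: cinner_def algebra_simps sum_subtractf)

lemma cinner_diff_left: "cinner n (\<lambda>k. y k - z k) x = cinner n y x - cinner n z x"
  by (simp add: cinner_def algebra_simps sum_subtractf)

lemma cinner_scale_right: "cinner n x (\<lambda>k. y k * a) = cinner n x y * a"
  by (simp add: cinner_def sum_distrib_right mult.assoc)

lemma cinner_divide_right: "cinner n x (\<lambda>k. y k / a) = cinner n x y / a"
  by (simp add: cinner_def sum_divide_distrib)

lemma cinner_scale_left: "cinner n (\<lambda>k. y k * a) x = cnj a * cinner n y x"
  by (simp add: cinner_def sum_distrib_left mult_ac)

lemma cinner_commute: "cinner n x y = cnj (cinner n y x)"
  by (simp add: cinner_def mult.commute)

lemma cinner_eq_0_if_vnorm_eq_0: "vnorm n g = 0 \<Longrightarrow> cinner n g x = 0"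
  unfolding vnorm_def cinner_def by (simp add: sum_nonneg_eq_0_iff)

definition zf_residual :: "nat \<Rightarrow> (nat \<Rightarrow> complex) \<Rightarrow> (nat \<Rightarrow> complex) \<Rightarrow> nat \<Rightarrow> complex" where
  "zf_residual n g h = (\<lambda>k. h k - g k * (cinner n g h / of_real ((vnorm n g)\<^sup>2)))"

lemma ic_prec_zf_residual:
  "ic_prec n g h = (\<lambda>k. zf_residual n g h k / of_real (vnorm n (zf_residual n g h)))"
  unfolding ic_prec_def zf_residual_def Let_def by simp

text \<open>If the norm of \<open>g\<close> vanishes, so do its first \<open>n\<close> entries, and
  the claim is trivial. The cancellation therefore holds for every outcome and not merely almost
  surely.\<close>

lemma cinner_zf_residual: "cinner n g (zf_residual n g h) = 0"
proof (cases "vnorm n g = 0")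
  case False
  then show ?thesis
    unfolding zf_residual_def cinner_diff_right cinner_scale_right cinner_self by simp
qed (simp add: cinner_eq_0_if_vnorm_eq_0)

lemma cinner_ic_prec_other: "cinner n g (ic_prec n g h) = 0"
  unfolding ic_prec_zf_residual cinner_divide_right cinner_zf_residual by simp

text \<open>The residual \<open>w\<close> is orthogonal to \<open>g\<close>, so its inner product
  with \<open>h\<close> equals its own squared norm; after normalisation the norm of
  \<open>w\<close> remains, and Pythagoras evaluates its square. Since division by zero gives 0,
  this includes \<open>w = 0\<close>.\<close>

lemma cinner_ic_prec:
  "(cmod (cinner n h (ic_prec n g h)))\<^sup>2 = (vnorm n h)\<^sup>2 - (cmod (cinner n g h))\<^sup>2 / (vnorm n g)\<^sup>2"
proof -
  let ?w = "zf_residual n g h"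
  have hw: "cinner n h ?w = of_real ((vnorm n h)\<^sup>2 - (cmod (cinner n g h))\<^sup>2 / (vnorm n g)\<^sup>2)"
  proof -
    have "cinner n h ?w = cinner n h h - cinner n h g * (cinner n g h / of_real ((vnorm n g)\<^sup>2))"
      unfolding zf_residual_def cinner_diff_right cinner_scale_right ..
    also have "cinner n h g * (cinner n g h / of_real ((vnorm n g)\<^sup>2))
        = of_real ((cmod (cinner n g h))\<^sup>2 / (vnorm n g)\<^sup>2)"
      using complex_norm_square[of "cinner n g h"] by (subst cinner_commute) (simp add: mult.commute)
    finally show ?thesis by (simp add: cinner_self)
  qed
  have "of_real ((vnorm n ?w)\<^sup>2) = cinner n ?w ?w"
    by (simp add: cinner_self)
  also have "\<dots> = cinner n h ?w - cnj (cinner n g h / of_real ((vnorm n g)\<^sup>2)) * cinner n g ?w"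
    by (subst zf_residual_def) (simp only: cinner_diff_left cinner_scale_left)
  finally have "complex_of_real ((vnorm n ?w)\<^sup>2) = cinner n h ?w"
    by (simp add: cinner_zf_residual)
  then have "cinner n h (ic_prec n g h) = of_real (vnorm n ?w)"
    unfolding ic_prec_zf_residual cinner_divide_right by (simp flip: \<open>_ = cinner n h ?w\<close> add: power2_eq_square)
  moreover have "(vnorm n ?w)\<^sup>2 = (vnorm n h)\<^sup>2 - (cmod (cinner n g h))\<^sup>2 / (vnorm n g)\<^sup>2"
    using \<open>_ = cinner n h ?w\<close> hw by (metis of_real_eq_iff)
  ultimately show ?thesis by simp
qed

subsection \<open>Independence of the channel blocks\<close>

abbreviation block_index :: "nat \<Rightarrow> nat \<Rightarrow> nat \<Rightarrow> (nat \<times> nat \<times> nat) set" where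
  "block_index n i j \<equiv> {i} \<times> {j} \<times> {..<n}"

abbreviation block :: "nat \<Rightarrow> nat \<Rightarrow> nat \<Rightarrow> (nat \<times> nat \<times> nat \<Rightarrow> complex) \<Rightarrow> nat \<Rightarrow> complex" where
  "block n i j \<omega> \<equiv> (\<lambda>k\<in>{..<n}. chan \<omega> i j k)"

abbreviation CN_prod :: "(nat \<times> nat \<times> nat) set \<Rightarrow> (nat \<times> nat \<times> nat \<Rightarrow> complex) measure" where
  "CN_prod K \<equiv> PiM K (\<lambda>_. CN_std)"

lemma measurable_block:
  "block_index n i j \<subseteq> K \<Longrightarrow> block n i j \<in> measurable (CN_prod K) (CN_vec n)"
  unfolding chan_def by (intro measurable_restrict measurable_component_singleton) auto

text \<open>A product measure over a disjoint union is a product of two; relabelling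
  \<open>(i, j, k)\<close> as \<open>k\<close> identifies the block with \<open>CN_vec n\<close>.
  The restriction to \<open>K\<close> makes the second argument of \<open>G\<close> a point of the
  smaller product space.\<close>

lemma nn_integral_split_block:
  fixes G :: "(nat \<Rightarrow> complex) \<Rightarrow> (nat \<times> nat \<times> nat \<Rightarrow> complex) \<Rightarrow> ennreal"
  assumes K: "finite K" "block_index n i j \<inter> K = {}"
    and G[measurable]: "case_prod G \<in> borel_measurable (CN_vec n \<Otimes>\<^sub>M CN_prod K)"
  shows "(\<integral>\<^sup>+\<omega>. G (block n i j \<omega>) (restrict \<omega> K) \<partial>CN_prod (block_index n i j \<union> K))
       = (\<integral>\<^sup>+h. \<integral>\<^sup>+\<omega>. G h \<omega> \<partial>CN_prod K \<partial>CN_vec n)"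
proof -
  let ?B = "block_index n i j"
  interpret product_prob_space "\<lambda>_::nat \<times> nat \<times> nat. CN_std"
    by (rule product_prob_space_CN_std)
  interpret K: prob_space "CN_prod K"
    by (intro prob_space_PiM prob_space_CN_std)
  have [measurable]: "block n i j \<in> measurable (CN_prod (?B \<union> K)) (CN_vec n)"
      "block n i j \<in> measurable (CN_prod ?B) (CN_vec n)"
      "(\<lambda>\<omega>. restrict \<omega> K) \<in> measurable (CN_prod (?B \<union> K)) (CN_prod K)"
    by (auto intro!: measurable_block measurable_restrict_subset)
  have "(\<integral>\<^sup>+\<omega>. G (block n i j \<omega>) (restrict \<omega> K) \<partial>CN_prod (?B \<union> K))
     = (\<integral>\<^sup>+x. \<integral>\<^sup>+y. G (block n i j (merge ?B K (x, y))) (restrict (merge ?B K (x, y)) K) \<partial>CN_prod K \<partial>CN_prod ?B)"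
    using K by (intro product_nn_integral_fold) auto
  also have "\<dots> = (\<integral>\<^sup>+x. \<integral>\<^sup>+y. G (block n i j x) y \<partial>CN_prod K \<partial>CN_prod ?B)"
  proof (intro nn_integral_cong)
    fix x y assume "y \<in> space (CN_prod K)"
    then have "restrict y K = y"
      by (auto simp: space_PiM)
    then have "restrict (merge ?B K (x, y)) K = y"
      using K by simp
    moreover have "block n i j (merge ?B K (x, y)) = block n i j x"
      by (auto simp: chan_def merge_def)
    ultimately show "G (block n i j (merge ?B K (x, y))) (restrict (merge ?B K (x, y)) K) = G (block n i j x) y"
      by (simp only:)
  qed
  also have "\<dots> = (\<integral>\<^sup>+h. \<integral>\<^sup>+y. G h y \<partial>CN_prod K \<partial>distr (CN_prod ?B) (CN_vec n) (block n i j))"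
    by (rule nn_integral_distr[symmetric]) measurable
  also have "distr (CN_prod ?B) (CN_vec n) (block n i j) = CN_vec n"
    unfolding chan_def
    by (rule distr_PiM_reindex[where f="\<lambda>k. (i, j, k)" and M="\<lambda>_. CN_std"])
       (auto simp: inj_on_def prob_space_CN_std)
  finally show ?thesis .
qed

lemma nn_integral_chan_space:
  fixes F :: "(nat \<Rightarrow> complex) \<Rightarrow> (nat \<Rightarrow> complex) \<Rightarrow> (nat \<Rightarrow> complex) \<Rightarrow> (nat \<Rightarrow> complex) \<Rightarrow> ennreal"
  assumes F: "(\<lambda>(a, b, c, d). F a b c d) \<in> borel_measurable (CN_vec n \<Otimes>\<^sub>M CN_vec n \<Otimes>\<^sub>M CN_vec n \<Otimes>\<^sub>M CN_vec n)"
  shows "(\<integral>\<^sup>+\<omega>. F (block n 1 1 \<omega>) (block n 2 1 \<omega>) (block n 1 2 \<omega>) (block n 2 2 \<omega>) \<partial>chan_space n)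
       = (\<integral>\<^sup>+a. \<integral>\<^sup>+b. \<integral>\<^sup>+c. \<integral>\<^sup>+d. F a b c d \<partial>CN_vec n \<partial>CN_vec n \<partial>CN_vec n \<partial>CN_vec n)"
proof -
  let ?B = "block_index n"
  define K1 where "K1 = ?B 2 2"
  define K2 where "K2 = ?B 1 2 \<union> K1"
  define K3 where "K3 = ?B 2 1 \<union> K2"
  have K: "{1, 2} \<times> {1, 2} \<times> {..<n} = ?B 1 1 \<union> K3"
    unfolding K1_def K2_def K3_def by auto
  have [measurable]: "block n 2 1 \<in> measurable (CN_prod K3) (CN_vec n)"
      "block n 1 2 \<in> measurable (CN_prod K3) (CN_vec n)"
      "block n 2 2 \<in> measurable (CN_prod K3) (CN_vec n)"
      "block n 1 2 \<in> measurable (CN_prod K2) (CN_vec n)"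
      "block n 2 2 \<in> measurable (CN_prod K2) (CN_vec n)"
      "block n 2 2 \<in> measurable (CN_prod K1) (CN_vec n)"
    by (auto intro!: measurable_block simp: K1_def K2_def K3_def)
  \<comment> \<open>Joint measurability of the uncurried \<open>F\<close> is turned into a
    composition rule, so that the partial applications arising below are handled
    automatically.\<close>
  have [measurable]: "(\<lambda>x. F (f x) (g x) (h x) (k x)) \<in> borel_measurable M"
    if [measurable]: "f \<in> measurable M (CN_vec n)" "g \<in> measurable M (CN_vec n)"
      "h \<in> measurable M (CN_vec n)" "k \<in> measurable M (CN_vec n)"
    for f g h k and M :: "'z measure"
  proof -
    have "(\<lambda>x. (f x, g x, h x, k x)) \<in> measurable M (CN_vec n \<Otimes>\<^sub>M CN_vec n \<Otimes>\<^sub>M CN_vec n \<Otimes>\<^sub>M CN_vec n)"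
      by measurable
    from measurable_compose[OF this F] show ?thesis by simp
  qed
  have r: "block n i j (restrict \<omega> K) = block n i j \<omega>" if "?B i j \<subseteq> K" for i j \<omega> K
    using that by (auto simp: chan_def restrict_def fun_eq_iff)
  have rr: "block n 2 1 (restrict \<omega> K3) = block n 2 1 \<omega>"
      "block n 1 2 (restrict \<omega> K3) = block n 1 2 \<omega>" "block n 2 2 (restrict \<omega> K3) = block n 2 2 \<omega>"
      "block n 1 2 (restrict \<omega> K2) = block n 1 2 \<omega>" "block n 2 2 (restrict \<omega> K2) = block n 2 2 \<omega>"
      "block n 2 2 (restrict \<omega> K1) = block n 2 2 \<omega>" for \<omega>
    by (auto intro!: r simp only: K1_def K2_def K3_def)
  have "(\<integral>\<^sup>+\<omega>. F (block n 1 1 \<omega>) (block n 2 1 \<omega>) (block n 1 2 \<omega>) (block n 2 2 \<omega>) \<partial>chan_space n)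
     = (\<integral>\<^sup>+\<omega>. F (block n 1 1 \<omega>) (block n 2 1 (restrict \<omega> K3)) (block n 1 2 (restrict \<omega> K3)) (block n 2 2 (restrict \<omega> K3))
          \<partial>CN_prod (?B 1 1 \<union> K3))"
    by (simp only: chan_space_def K rr)
  also have "\<dots> = (\<integral>\<^sup>+a. \<integral>\<^sup>+\<omega>. F a (block n 2 1 \<omega>) (block n 1 2 \<omega>) (block n 2 2 \<omega>) \<partial>CN_prod K3 \<partial>CN_vec n)"
    by (rule nn_integral_split_block[where G="\<lambda>a \<omega>. F a (block n 2 1 \<omega>) (block n 1 2 \<omega>) (block n 2 2 \<omega>)"])
       (simp add: K1_def K2_def K3_def, force simp: K1_def K2_def K3_def, measurable)
  also have "\<dots> = (\<integral>\<^sup>+a. \<integral>\<^sup>+\<omega>. F a (block n 2 1 \<omega>) (block n 1 2 (restrict \<omega> K2)) (block n 2 2 (restrict \<omega> K2))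
        \<partial>CN_prod (?B 2 1 \<union> K2) \<partial>CN_vec n)"
    by (simp only: rr K3_def)
  also have "\<dots> = (\<integral>\<^sup>+a. \<integral>\<^sup>+b. \<integral>\<^sup>+\<omega>. F a b (block n 1 2 \<omega>) (block n 2 2 \<omega>) \<partial>CN_prod K2 \<partial>CN_vec n \<partial>CN_vec n)"
    by (rule nn_integral_cong, rule nn_integral_split_block[where G="\<lambda>b \<omega>. F _ b (block n 1 2 \<omega>) (block n 2 2 \<omega>)"])
       (simp add: K1_def K2_def K3_def, force simp: K1_def K2_def K3_def, measurable)
  also have "\<dots> = (\<integral>\<^sup>+a. \<integral>\<^sup>+b. \<integral>\<^sup>+\<omega>. F a b (block n 1 2 \<omega>) (block n 2 2 (restrict \<omega> K1))
        \<partial>CN_prod (?B 1 2 \<union> K1) \<partial>CN_vec n \<partial>CN_vec n)"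
    by (simp only: rr K2_def)
  also have "\<dots> = (\<integral>\<^sup>+a. \<integral>\<^sup>+b. \<integral>\<^sup>+c. \<integral>\<^sup>+\<omega>. F a b c (block n 2 2 \<omega>) \<partial>CN_prod K1 \<partial>CN_vec n \<partial>CN_vec n \<partial>CN_vec n)"
    by (intro nn_integral_cong, rule nn_integral_split_block[where G="\<lambda>c \<omega>. F _ _ c (block n 2 2 \<omega>)"])
       (simp add: K1_def K2_def K3_def, force simp: K1_def K2_def K3_def, measurable)
  also have "\<dots> = (\<integral>\<^sup>+a. \<integral>\<^sup>+b. \<integral>\<^sup>+c. \<integral>\<^sup>+d. F a b c d \<partial>CN_vec n \<partial>CN_vec n \<partial>CN_vec n \<partial>CN_vec n)"
  proof (intro nn_integral_cong)
    fix a b c assume [measurable]: "a \<in> space (CN_vec n)" "b \<in> space (CN_vec n)" "c \<in> space (CN_vec n)"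
    \<comment> \<open>The last block is split off against the empty index set, whose product space
      is a single point.\<close>
    have "(\<integral>\<^sup>+\<omega>. F a b c (block n 2 2 \<omega>) \<partial>CN_prod (?B 2 2 \<union> {}))
       = (\<integral>\<^sup>+d. \<integral>\<^sup>+\<omega>. F a b c d \<partial>CN_prod {} \<partial>CN_vec n)"
      by (rule nn_integral_split_block[where G="\<lambda>d \<omega>. F a b c d"]) (simp, simp, measurable)
    also have "\<dots> = (\<integral>\<^sup>+d. F a b c d \<partial>CN_vec n)"
      by (simp add: PiM_empty nn_integral_count_space_finite)
    finally show "(\<integral>\<^sup>+\<omega>. F a b c (block n 2 2 \<omega>) \<partial>CN_prod K1) = (\<integral>\<^sup>+d. F a b c d \<partial>CN_vec n)"
      by (simp add: K1_def)
  qed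
  finally show ?thesis .
qed

subsection \<open>Rates\<close>

lemma measurable_cinner_pair[measurable (raw)]:
  assumes f: "f \<in> measurable M (CN_vec n)" and g: "g \<in> measurable M (CN_vec n)"
  shows "(\<lambda>x. cinner n (f x) (g x)) \<in> borel_measurable M"
proof -
  have "(\<lambda>x. cnj (f x k) * g x k) \<in> borel_measurable M" if "k \<in> {..<n}" for k
  proof -
    have "(\<lambda>x. f x k) \<in> borel_measurable M" "(\<lambda>x. g x k) \<in> borel_measurable M"
      using that measurable_compose[OF f measurable_component_singleton[of k]]
        measurable_compose[OF g measurable_component_singleton[of k]]
      by (simp_all cong: measurable_cong_sets)
    moreover have "cnj \<in> borel_measurable borel"
      by (intro borel_measurable_continuous_onI continuous_intros)
    ultimately show ?thesis by measurable
  qed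
  then show ?thesis
    unfolding cinner_def by (rule borel_measurable_sum)
qed

lemma measurable_vnorm[measurable (raw)]:
  assumes f: "f \<in> measurable M (CN_vec n)"
  shows "(\<lambda>x. vnorm n (f x)) \<in> borel_measurable M"
proof -
  have "vnorm n h = sqrt (Re (cinner n h h))" for h
    by (simp add: cinner_self)
  then show ?thesis
    using f by simp
qed

text \<open>Here and in \<open>interference_gain\<close>, \<open>g\<close> is the channel towards
  the user of the other cell and \<open>h\<close> the own direct channel. The norm of the
  zero-forcing residual has been eliminated, so measurability and the projection law apply
  directly.\<close>

definition signal_gain :: "nat \<Rightarrow> strategy \<Rightarrow> (nat \<Rightarrow> complex) \<Rightarrow> (nat \<Rightarrow> complex) \<Rightarrow> real" where
  "signal_gain n s g h = (case s of BF \<Rightarrow> (vnorm n h)\<^sup>2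
     | IC \<Rightarrow> (vnorm n h)\<^sup>2 - (cmod (cinner n g h))\<^sup>2 / (vnorm n g)\<^sup>2)"

definition interference_gain :: "nat \<Rightarrow> strategy \<Rightarrow> (nat \<Rightarrow> complex) \<Rightarrow> (nat \<Rightarrow> complex) \<Rightarrow> real" where
  "interference_gain n s g h = (case s of BF \<Rightarrow> (cmod (cinner n h g))\<^sup>2 / (vnorm n h)\<^sup>2 | IC \<Rightarrow> 0)"

lemma measurable_signal_gain[measurable (raw)]:
  "f \<in> measurable M (CN_vec n) \<Longrightarrow> g \<in> measurable M (CN_vec n) \<Longrightarrow>
    (\<lambda>x. signal_gain n s (f x) (g x)) \<in> borel_measurable M"
  unfolding signal_gain_def by (cases s) simp_all

lemma measurable_interference_gain[measurable (raw)]: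
  "f \<in> measurable M (CN_vec n) \<Longrightarrow> g \<in> measurable M (CN_vec n) \<Longrightarrow>
    (\<lambda>x. interference_gain n s (f x) (g x)) \<in> borel_measurable M"
  unfolding interference_gain_def by (cases s) simp_all

lemma cinner_restrict: "cinner n (restrict x {..<n}) (restrict y {..<n}) = cinner n x y"
  by (simp add: cinner_def)

lemma vnorm_restrict: "vnorm n (restrict x {..<n}) = vnorm n x"
  by (simp add: vnorm_def)

lemma SINR1_gains:
  "SINR1 n P Q s1 s2 \<omega> = P * signal_gain n s1 (block n 2 1 \<omega>) (block n 1 1 \<omega>)
     / (1 + Q * interference_gain n s2 (block n 1 2 \<omega>) (block n 2 2 \<omega>))"
  unfolding SINR1_def Let_def prec_def signal_gain_def interference_gain_def cinner_restrict vnorm_restrict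
  by (cases s1; cases s2)
     (simp_all add: cinner_bf_prec cinner_ic_prec cinner_bf_prec_other cinner_ic_prec_other)

section \<open>Laws of the signal and interference gains\<close>

lemma nn_integral_signal_gain_BF:
  assumes [measurable]: "f \<in> borel_measurable borel"
  shows "(\<integral>\<^sup>+h. \<integral>\<^sup>+g. f (signal_gain (Suc n) BF g h) \<partial>CN_vec (Suc n) \<partial>CN_vec (Suc n))
       = (\<integral>\<^sup>+x. ennreal (erlang_density n 1 x) * f x \<partial>lborel)"
proof -
  interpret V: prob_space "CN_vec (Suc n)" by (rule prob_space_CN_vec)
  show ?thesis
    by (simp add: signal_gain_def V.emeasure_space_1 nn_integral_CN_vec_vnorm_square)
qed

text \<open>With the cancelled channel \<open>g\<close> frozen, the gain is the residual of
  \<open>h\<close> orthogonal to \<open>g\<close>, with \<open>Suc n\<close> of the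
  \<open>Suc (Suc n)\<close> dimensions left; hence Erlang index \<open>n\<close>, and at least two
  antennas.\<close>

lemma nn_integral_signal_gain_IC:
  assumes [measurable]: "f \<in> borel_measurable borel"
  shows "(\<integral>\<^sup>+h. \<integral>\<^sup>+g. f (signal_gain (Suc (Suc n)) IC g h) \<partial>CN_vec (Suc (Suc n)) \<partial>CN_vec (Suc (Suc n)))
       = (\<integral>\<^sup>+x. ennreal (erlang_density n 1 x) * f x \<partial>lborel)"
proof -
  let ?V = "CN_vec (Suc (Suc n))"
  interpret V: prob_space ?V by (rule prob_space_CN_vec)
  interpret CN: prob_space CN_std by (rule prob_space_CN_std)
  interpret P: pair_sigma_finite ?V ?V ..
  have "(\<integral>\<^sup>+h. \<integral>\<^sup>+g. f (signal_gain (Suc (Suc n)) IC g h) \<partial>?V \<partial>?V)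
      = (\<integral>\<^sup>+g. \<integral>\<^sup>+h. f (signal_gain (Suc (Suc n)) IC g h) \<partial>?V \<partial>?V)"
    by (rule P.Fubini'[symmetric]) measurable
  also have "\<dots> = (\<integral>\<^sup>+g. (\<integral>\<^sup>+x. ennreal (erlang_density n 1 x) * f x \<partial>lborel) \<partial>?V)"
  proof (rule nn_integral_cong_AE)
    show "AE g in ?V. (\<integral>\<^sup>+h. f (signal_gain (Suc (Suc n)) IC g h) \<partial>?V)
        = (\<integral>\<^sup>+x. ennreal (erlang_density n 1 x) * f x \<partial>lborel)"
      using AE_CN_vec_vnorm_neq_0
    proof eventually_elim
      case (elim g)
      show ?case
        using nn_integral_CN_vec_projection_norm[OF _ elim, of "\<lambda>_. f"]
        by (simp add: signal_gain_def CN.emeasure_space_1 nn_integral_CN_vec_vnorm_square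
            CN.emeasure_space_1[simplified])
    qed
  qed
  finally show ?thesis
    by (simp add: V.emeasure_space_1)
qed

text \<open>Here the serving channel \<open>h\<close> is frozen, since the beam points along it, and
  the cross channel \<open>g\<close> is projected onto that direction.\<close>

lemma nn_integral_interference_gain_BF:
  assumes [measurable]: "f \<in> borel_measurable borel"
  shows "(\<integral>\<^sup>+g. \<integral>\<^sup>+h. f (interference_gain (Suc n) BF g h) \<partial>CN_vec (Suc n) \<partial>CN_vec (Suc n))
       = (\<integral>\<^sup>+y. ennreal (exponential_density 1 y) * f y \<partial>lborel)"
proof -
  let ?V = "CN_vec (Suc n)"
  interpret V: prob_space ?V by (rule prob_space_CN_vec)
  interpret V': prob_space "CN_vec n" by (rule prob_space_CN_vec)
  interpret P: pair_sigma_finite ?V ?V ..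
  have "(\<integral>\<^sup>+g. \<integral>\<^sup>+h. f (interference_gain (Suc n) BF g h) \<partial>?V \<partial>?V)
      = (\<integral>\<^sup>+h. \<integral>\<^sup>+g. f (interference_gain (Suc n) BF g h) \<partial>?V \<partial>?V)"
    by (rule P.Fubini'[symmetric]) measurable
  also have "\<dots> = (\<integral>\<^sup>+h. (\<integral>\<^sup>+y. ennreal (exponential_density 1 y) * f y \<partial>lborel) \<partial>?V)"
  proof (rule nn_integral_cong_AE)
    show "AE h in ?V. (\<integral>\<^sup>+g. f (interference_gain (Suc n) BF g h) \<partial>?V)
        = (\<integral>\<^sup>+y. ennreal (exponential_density 1 y) * f y \<partial>lborel)"
      using AE_CN_vec_vnorm_neq_0
    proof eventually_elim
      case (elim h)
      show ?case
        using nn_integral_CN_vec_projection_norm[OF _ elim, of "\<lambda>y _. f y"]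
        by (simp add: interference_gain_def V'.emeasure_space_1 nn_integral_CN_std_norm_square)
    qed
  qed
  finally show ?thesis
    by (simp add: V.emeasure_space_1)
qed

lemma nn_integral_interference_gain_IC:
  "(\<integral>\<^sup>+g. \<integral>\<^sup>+h. f (interference_gain n IC g h) \<partial>CN_vec n \<partial>CN_vec n) = f 0"
proof -
  interpret V: prob_space "CN_vec n" by (rule prob_space_CN_vec)
  show ?thesis
    by (simp add: interference_gain_def V.emeasure_space_1)
qed

section \<open>From the gain laws to the four rates\<close>

lemma rate1_eq_gain_integral:
  assumes P: "P > 0" and Q: "Q > 0"
  shows "rate1 n P Q s1 s2 = enn2real (\<integral>\<^sup>+a. \<integral>\<^sup>+b. \<integral>\<^sup>+c. \<integral>\<^sup>+d.
    ennreal (log 2 (1 + P * signal_gain n s1 b a / (1 + Q * interference_gain n s2 c d)))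
      \<partial>CN_vec n \<partial>CN_vec n \<partial>CN_vec n \<partial>CN_vec n)"
proof -
  have [measurable]: "block n i j \<in> measurable (chan_space n) (CN_vec n)"
    if "i \<in> {1, 2}" "j \<in> {1, 2}" for i j
    unfolding chan_space_def using that by (intro measurable_block) auto
  \<comment> \<open>Nonnegativity is read off the squared moduli in \<open>SINR1\<close>; in terms
    of the gains it is hidden, since the IC signal gain is a difference.\<close>
  have "SINR1 n P Q s1 s2 \<omega> \<ge> 0" for \<omega>
    using P Q unfolding SINR1_def Let_def by (intro divide_nonneg_nonneg mult_nonneg_nonneg add_nonneg_nonneg) auto
  then have "rate1 n P Q s1 s2 = enn2real (\<integral>\<^sup>+\<omega>. ennreal (log 2 (1 + SINR1 n P Q s1 s2 \<omega>)) \<partial>chan_space n)"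
    unfolding rate1_def
  proof (intro integral_eq_nn_integral)
    show "(\<lambda>\<omega>. log 2 (1 + SINR1 n P Q s1 s2 \<omega>)) \<in> borel_measurable (chan_space n)"
      unfolding SINR1_gains by simp
  qed (simp add: add_pos_nonneg)
  also have "(\<integral>\<^sup>+\<omega>. ennreal (log 2 (1 + SINR1 n P Q s1 s2 \<omega>)) \<partial>chan_space n)
     = (\<integral>\<^sup>+a. \<integral>\<^sup>+b. \<integral>\<^sup>+c. \<integral>\<^sup>+d.
    ennreal (log 2 (1 + P * signal_gain n s1 b a / (1 + Q * interference_gain n s2 c d)))
      \<partial>CN_vec n \<partial>CN_vec n \<partial>CN_vec n \<partial>CN_vec n)"
    unfolding SINR1_gains by (rule nn_integral_chan_space) measurable
  finally show ?thesis .
qed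

text \<open>The strategy of BS 1 enters only through the Erlang index \<open>m\<close> of its signal
  gain, so the assumption \<open>law\<close> lets one argument serve both choices of
  \<open>s\<close>.\<close>

lemma rate1_interference_BF:
  assumes P: "P > 0" and Q: "Q > 0" and n: "n > 0"
    and law: "\<And>f. f \<in> borel_measurable borel \<Longrightarrow>
      (\<integral>\<^sup>+h. \<integral>\<^sup>+g. f (signal_gain n s g h) \<partial>CN_vec n \<partial>CN_vec n)
        = (\<integral>\<^sup>+x. ennreal (erlang_density m 1 x) * f x \<partial>lborel)"
  shows "rate1 n P Q s BF = R_I2 P Q (Suc m)"
proof -
  define G where "G = (\<lambda>x y. ennreal (log 2 (1 + P * x / (1 + Q * y))))"
  have [measurable]: "case_prod G \<in> borel_measurable (borel \<Otimes>\<^sub>M borel)"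
    unfolding G_def by measurable
  obtain p where p: "n = Suc p"
    using n gr0_implies_Suc by blast
  have "(\<integral>\<^sup>+a. \<integral>\<^sup>+b. \<integral>\<^sup>+c. \<integral>\<^sup>+d. G (signal_gain n s b a) (interference_gain n BF c d)
      \<partial>CN_vec n \<partial>CN_vec n \<partial>CN_vec n \<partial>CN_vec n)
    = (\<integral>\<^sup>+a. \<integral>\<^sup>+b. \<integral>\<^sup>+y. ennreal (exponential_density 1 y) * G (signal_gain n s b a) y \<partial>lborel \<partial>CN_vec n \<partial>CN_vec n)"
    unfolding p by (intro nn_integral_cong nn_integral_interference_gain_BF) measurable
  also have "\<dots> = (\<integral>\<^sup>+x. ennreal (erlang_density m 1 x) *
      (\<integral>\<^sup>+y. ennreal (exponential_density 1 y) * G x y \<partial>lborel) \<partial>lborel)"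
    by (rule law[where f="\<lambda>x. \<integral>\<^sup>+y. ennreal (exponential_density 1 y) * G x y \<partial>lborel"]) measurable
  also have "\<dots> = (\<integral>\<^sup>+x. \<integral>\<^sup>+y. ennreal (erlang_density m 1 x) * (ennreal (exponential_density 1 y) * G x y) \<partial>lborel \<partial>lborel)"
    by (intro nn_integral_cong nn_integral_cmult[symmetric]) measurable
  also have "\<dots> = (\<integral>\<^sup>+y. \<integral>\<^sup>+x. ennreal (erlang_density m 1 x) * (ennreal (exponential_density 1 y) * G x y) \<partial>lborel \<partial>lborel)"
    by (rule lborel_pair.Fubini') measurable
  also have "\<dots> = (\<integral>\<^sup>+y. ennreal (exponential_density 1 y) *
      (\<integral>\<^sup>+x. ennreal (erlang_density m 1 x) * G x y \<partial>lborel) \<partial>lborel)"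
    by (subst mult.left_commute, intro nn_integral_cong nn_integral_cmult) measurable
  also have "\<dots> = ennreal (R_I2 P Q (Suc m))"
    unfolding G_def by (rule erlang_expectation_log_R_I2[OF P Q])
  finally show ?thesis
    unfolding rate1_eq_gain_integral[OF P Q] G_def by (simp add: R_I2_nonneg[OF P Q])
qed

lemma rate1_interference_IC:
  assumes P: "P > 0" and Q: "Q > 0"
    and law: "\<And>f. f \<in> borel_measurable borel \<Longrightarrow>
      (\<integral>\<^sup>+h. \<integral>\<^sup>+g. f (signal_gain n s g h) \<partial>CN_vec n \<partial>CN_vec n)
        = (\<integral>\<^sup>+x. ennreal (erlang_density m 1 x) * f x \<partial>lborel)"
  shows "rate1 n P Q s IC = R_BF P (Suc m)"
proof -
  have "(\<integral>\<^sup>+a. \<integral>\<^sup>+b. \<integral>\<^sup>+c. \<integral>\<^sup>+d.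
      ennreal (log 2 (1 + P * signal_gain n s b a / (1 + Q * interference_gain n IC c d)))
      \<partial>CN_vec n \<partial>CN_vec n \<partial>CN_vec n \<partial>CN_vec n)
    = (\<integral>\<^sup>+a. \<integral>\<^sup>+b. ennreal (log 2 (1 + P * signal_gain n s b a / (1 + Q * 0))) \<partial>CN_vec n \<partial>CN_vec n)"
    by (intro nn_integral_cong nn_integral_interference_gain_IC)
  also have "\<dots> = (\<integral>\<^sup>+x. ennreal (erlang_density m 1 x) * ennreal (log 2 (1 + P * x / (1 + Q * 0))) \<partial>lborel)"
    by (rule law[where f="\<lambda>x. ennreal (log 2 (1 + P * x / (1 + Q * 0)))"]) measurable
  also have "\<dots> = ennreal (R_BF P (Suc m))"
    using erlang_expectation_log_R_BF[OF P, of m] by simp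
  finally show ?thesis
    unfolding rate1_eq_gain_integral[OF P Q] by (simp add: R_BF_nonneg[OF P])
qed

theorem theorem1:
  fixes Nt :: nat and P11 P12 :: real
  assumes "Nt \<ge> 2" and "P11 > 0" and "P12 > 0"
  shows "rate1 Nt P11 P12 BF BF = R_I2 P11 P12 Nt
       \<and> rate1 Nt P11 P12 BF IC = R_BF P11 Nt
       \<and> rate1 Nt P11 P12 IC IC = R_BF P11 (Nt - 1)
       \<and> rate1 Nt P11 P12 IC BF = R_I2 P11 P12 (Nt - 1)"
proof -
  \<comment> \<open>With \<open>Nt = n + 2\<close> the signal has Erlang index \<open>n + 1\<close>
    under BF and \<open>n\<close> under IC, giving the arguments \<open>Nt\<close> and
    \<open>Nt - 1\<close>.\<close>
  obtain n where Nt: "Nt = Suc (Suc n)"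
    using assms(1) by (metis Suc_le_D numeral_2_eq_2 Suc_le_mono)
  have pos: "Suc (Suc n) > 0" by simp
  show ?thesis
    unfolding Nt
    using rate1_interference_BF[OF assms(2,3) pos nn_integral_signal_gain_BF]
      rate1_interference_IC[OF assms(2,3) nn_integral_signal_gain_BF]
      rate1_interference_IC[OF assms(2,3) nn_integral_signal_gain_IC]
      rate1_interference_BF[OF assms(2,3) pos nn_integral_signal_gain_IC]
    by simp
qed

end
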